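(* Let $\mathbb{X}$ be a real Banach space. Then $\mathbb{X}$ is reflexive if and only if for every closed hyperspace $H$ of $\mathbb{X}$ there exists a rank one linear operator $T\in\mathbb{L}(\mathbb{X})$ such that (i) $x\in M_T$ for some $x\in S_{\mathbb{X}}$, and (ii) $m_T=H\cap S_{\mathbb{X}}$.
   Context: $S_{\mathbb{X}}$ is the unit sphere of $\mathbb{X}$; $\mathbb{L}(\mathbb{X})$ is the space of bounded linear operators from $\mathbb{X}$ to itself. $M_T=\{x\in S_{\mathbb{X}}:\|Tx\|=\|T\|\}$ and $m_T=\{x\in S_{\mathbb{X}}:\|Tx\|=m(T)\}$, where $m(T)=\inf\{\|Tx\|:\|x\|=1\}$. A hyperspace is a linear subspace of codimension one.
   Formalization: One-dimensional spaces are excluded: there the claim fails, since X is reflexive and H = {0} is a closed hyperspace with H ∩ S_X empty, while every operator T has m_T = S_X, which is non-empty. *)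

theory Defs
  imports "HOL-Analysis.Analysis"
begin

lift_definition bidual_embedding ::
    "'a::real_normed_vector \<Rightarrow> (('a \<Rightarrow>\<^sub>L real) \<Rightarrow>\<^sub>L real)"
  is "\<lambda>x f. blinfun_apply f x"
  by (rule blinfun.bounded_linear_left)

definition reflexive_space :: "'a::real_normed_vector itself \<Rightarrow> bool" where
  "reflexive_space _ \<longleftrightarrow>
     surj (bidual_embedding :: 'a \<Rightarrow> (('a \<Rightarrow>\<^sub>L real) \<Rightarrow>\<^sub>L real))"

(* H need not be finite-dimensional, so codimension one is expressed by a
   one-dimensional algebraic complement L (isomorphic to the quotient by H). *)
definition hyperspace :: "'a::real_vector set \<Rightarrow> bool" where
  "hyperspace H \<longleftrightarrow>
     subspace H \<and>
     (\<exists>L. subspace L \<and> dim L = 1 \<and> H \<inter> L = {0} \<and> {h + l | h l. h \<in> H \<and> l \<in> L} = UNIV)"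

definition rank_one :: "('a::real_normed_vector \<Rightarrow>\<^sub>L 'a) \<Rightarrow> bool" where
  "rank_one T \<longleftrightarrow> dim (range (blinfun_apply T)) = 1"

definition norm_attainment_set :: "('a::real_normed_vector \<Rightarrow>\<^sub>L 'a) \<Rightarrow> 'a set" where
  "norm_attainment_set T = {x \<in> sphere 0 1. norm (blinfun_apply T x) = norm T}"

definition minimum_norm :: "('a::real_normed_vector \<Rightarrow>\<^sub>L 'a) \<Rightarrow> real" where
  "minimum_norm T = (INF x\<in>sphere 0 1. norm (blinfun_apply T x))"

definition minimum_norm_attainment_set :: "('a::real_normed_vector \<Rightarrow>\<^sub>L 'a) \<Rightarrow> 'a set" where
  "minimum_norm_attainment_set T =
     {x \<in> sphere 0 1. norm (blinfun_apply T x) = minimum_norm T}"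

end

theory Submission
  imports Defs
begin

text \<open>
  A rank one operator on a space of dimension other than one has minimum norm zero, attained exactly
  on its kernel; hence the condition says that every bounded functional attains its norm, and
  the theorem is James' theorem together with the Hahn--Banach theorem.

  For James' theorem, a functional on the dual that is far from the image of \<open>X\<close> yields
  functionals \<open>h\<^sub>n\<close> in the dual ball whose convex combinations stay away from all their limits.
  By Pryce's argument one passes to decreasing convex sets \<open>K\<^sub>n\<close> of tail combinations for which the
  supremum over the unit ball of \<open>f - lim sup K\<close> equals that of \<open>f - lim inf K\<close>. With weights
  \<open>r\<^sup>n\<close> for a small \<open>r\<close>, James' selection gives \<open>g\<^sub>n \<in> K\<^sub>n\<close> such that these suprema grow
  by a fixed multiple of \<open>r\<^sup>n\<close> at each partial sum. If \<open>w\<close> is a linear functional below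
  \<open>lim sup g\<^sub>n\<close> and \<open>\<Sum> r\<^sup>n (g\<^sub>n - w)\<close> attained its norm at \<open>x\<close>, then \<open>g\<^sub>n(x) - w(x)\<close>
  would be bounded below by a positive constant for every \<open>n\<close>, contradicting
  \<open>w(x) \<ge> lim inf g\<^sub>n(x)\<close>.
\<close>

section \<open>The Hahn--Banach theorem\<close>

definition sublinear :: "('a::real_vector \<Rightarrow> real) \<Rightarrow> bool" where
  "sublinear p \<longleftrightarrow>
     (\<forall>x y. p (x + y) \<le> p x + p y) \<and> (\<forall>t x. t \<ge> 0 \<longrightarrow> p (t *\<^sub>R x) = t * p x)"

lemma sublinear_add: "sublinear p \<Longrightarrow> p (x + y) \<le> p x + p y"
  and sublinear_scale: "sublinear p \<Longrightarrow> t \<ge> 0 \<Longrightarrow> p (t *\<^sub>R x) = t * p x"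
  by (auto simp: sublinear_def)

lemma sublinear_zero: "sublinear p \<Longrightarrow> p 0 = 0"
  using sublinear_scale[of p 0 0] by simp

lemma sublinear_minus: "sublinear p \<Longrightarrow> - p (- x) \<le> p x"
  using sublinear_add[of p x "-x"] sublinear_zero[of p] by simp

text \<open>Applying the scaling inequality with factor \<open>1/t\<close> at the point
  \<open>t *\<^sub>R x\<close> gives the reverse inequality, so one direction yields positive
  homogeneity.\<close>

lemma sublinearI:
  assumes add: "\<And>x y. p (x + y) \<le> p x + p y"
    and zero: "p 0 = 0"
    and scale: "\<And>t x. t > 0 \<Longrightarrow> p (t *\<^sub>R x) \<le> t * p x"
  shows "sublinear p"
  unfolding sublinear_def
proof (intro conjI allI impI)
  fix t :: real and x assume "t \<ge> 0"
  show "p (t *\<^sub>R x) = t * p x"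
  proof (cases "t = 0")
    case False
    then have t: "t > 0" using \<open>t \<ge> 0\<close> by simp
    have "p ((1/t) *\<^sub>R (t *\<^sub>R x)) \<le> (1/t) * p (t *\<^sub>R x)"
      using t by (intro scale) simp
    then have "t * p x \<le> p (t *\<^sub>R x)"
      using t by (simp add: field_simps)
    with scale[OF t, of x] show ?thesis by simp
  qed (simp add: zero)
qed (rule add)

text \<open>A minimal sublinear functional coincides with all its tilts, which makes it additive;
  a functional below the tilt of \<open>p\<close> in direction \<open>x0\<close> agrees with \<open>p\<close> at \<open>x0\<close>.\<close>

definition tilt :: "('a::real_vector \<Rightarrow> real) \<Rightarrow> 'a \<Rightarrow> 'a \<Rightarrow> real" where
  "tilt p y x = (INF t\<in>{0..}. p (x + t *\<^sub>R y) - t * p y)"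

lemma tilt_bdd:
  assumes "sublinear p"
  shows "bdd_below ((\<lambda>t. p (x + t *\<^sub>R y) - t * p y) ` {0..})"
proof (rule bdd_belowI2[where m = "- p (- x)"])
  fix t :: real assume "t \<in> {0..}"
  then have t: "t \<ge> 0" by simp
  have "t * p y = p ((x + t *\<^sub>R y) + (-x))"
    using sublinear_scale[OF assms t, of y] by simp
  also have "\<dots> \<le> p (x + t *\<^sub>R y) + p (-x)"
    by (rule sublinear_add[OF assms])
  finally show "- p (- x) \<le> p (x + t *\<^sub>R y) - t * p y" by simp
qed

lemma tilt_le:
  assumes "sublinear p" "t \<ge> 0"
  shows "tilt p y x \<le> p (x + t *\<^sub>R y) - t * p y"
  unfolding tilt_def by (rule cINF_lower[OF tilt_bdd[OF assms(1)]]) (use assms in simp)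

lemma tilt_ge:
  assumes "\<And>t. t \<ge> 0 \<Longrightarrow> c \<le> p (x + t *\<^sub>R y) - t * p y"
  shows "c \<le> tilt p y x"
  unfolding tilt_def by (rule cINF_greatest) (use assms in auto)

text \<open>Parameters \<open>t\<close> and \<open>t'\<close> for the two summands combine to
  \<open>t + t'\<close> for the sum. Each infimum is bounded separately after moving the other term
  across the inequality. Homogeneity is the substitution of \<open>s * t\<close> for
  \<open>t\<close>.\<close>

lemma sublinear_tilt:
  assumes p: "sublinear p"
  shows "sublinear (tilt p y)"
proof (rule sublinearI)
  fix x x'
  have "tilt p y (x + x') - tilt p y x \<le> tilt p y x'"
  proof (rule tilt_ge)
    fix t' :: real assume t': "t' \<ge> 0"
    have "tilt p y (x + x') - (p (x' + t' *\<^sub>R y) - t' * p y) \<le> tilt p y x"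
    proof (rule tilt_ge)
      fix t :: real assume t: "t \<ge> 0"
      have "tilt p y (x + x') \<le> p ((x + x') + (t + t') *\<^sub>R y) - (t + t') * p y"
        by (rule tilt_le[OF p]) (use t t' in simp)
      also have "p ((x + x') + (t + t') *\<^sub>R y) = p ((x + t *\<^sub>R y) + (x' + t' *\<^sub>R y))"
        by (simp add: algebra_simps)
      also have "\<dots> \<le> p (x + t *\<^sub>R y) + p (x' + t' *\<^sub>R y)"
        by (rule sublinear_add[OF p])
      finally show "tilt p y (x + x') - (p (x' + t' *\<^sub>R y) - t' * p y) \<le> p (x + t *\<^sub>R y) - t * p y"
        by (simp add: algebra_simps)
    qed
    then show "tilt p y (x + x') - tilt p y x \<le> p (x' + t' *\<^sub>R y) - t' * p y" by simp
  qed
  then show "tilt p y (x + x') \<le> tilt p y x + tilt p y x'" by simp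
next
  have "tilt p y 0 \<le> 0"
    using tilt_le[OF p, of 0 y 0] sublinear_zero[OF p] by simp
  moreover have "0 \<le> tilt p y 0"
    by (rule tilt_ge) (simp add: sublinear_scale[OF p])
  ultimately show "tilt p y 0 = 0" by simp
next
  fix s :: real and x assume s: "s > 0"
  have "tilt p y (s *\<^sub>R x) / s \<le> tilt p y x"
  proof (rule tilt_ge)
    fix t :: real assume t: "t \<ge> 0"
    have "tilt p y (s *\<^sub>R x) \<le> p (s *\<^sub>R x + (s * t) *\<^sub>R y) - (s * t) * p y"
      by (rule tilt_le[OF p]) (use s t in simp)
    also have "p (s *\<^sub>R x + (s * t) *\<^sub>R y) = s * p (x + t *\<^sub>R y)"
      using sublinear_scale[OF p, of s "x + t *\<^sub>R y"] s by (simp add: algebra_simps)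
    finally show "tilt p y (s *\<^sub>R x) / s \<le> p (x + t *\<^sub>R y) - t * p y"
      using s by (simp add: field_simps)
  qed
  then show "tilt p y (s *\<^sub>R x) \<le> s * tilt p y x"
    using s by (simp add: field_simps)
qed

text \<open>Of two members of a chain one lies below both, so in the subadditivity estimate the
  infima for \<open>x\<close> and \<open>y\<close> may be approached by different members. The
  common bound \<open>- p (- x)\<close> keeps the infimum finite.\<close>

lemma sublinear_INF_chain:
  assumes ne: "C \<noteq> {}"
    and sub: "\<And>q. q \<in> C \<Longrightarrow> sublinear q \<and> q \<le> p"
    and p: "sublinear p"
    and chain: "\<And>q r. q \<in> C \<Longrightarrow> r \<in> C \<Longrightarrow> q \<le> r \<or> r \<le> q"
  shows "sublinear (\<lambda>x. INF q\<in>C. q x)"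
    and "\<And>q x. q \<in> C \<Longrightarrow> (INF q\<in>C. q x) \<le> q x"
proof -
  have bdd: "bdd_below ((\<lambda>q. q x) ` C)" for x
  proof (rule bdd_belowI2[where m = "- p (- x)"])
    fix q assume "q \<in> C"
    with sub have "sublinear q" "q (- x) \<le> p (- x)" by (auto simp: le_fun_def)
    then show "- p (- x) \<le> q x"
      using sublinear_minus[of q "x"] by simp
  qed
  show low: "(INF q\<in>C. q x) \<le> q x" if "q \<in> C" for q x
    by (rule cINF_lower[OF bdd that])
  let ?m = "\<lambda>x. INF q\<in>C. q x"
  show "sublinear ?m"
  proof (rule sublinearI)
    fix x y
    have "?m (x + y) - ?m x \<le> ?m y"
    proof (rule cINF_greatest[OF ne])
      fix r assume r: "r \<in> C"
      have "?m (x + y) - r y \<le> ?m x"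
      proof (rule cINF_greatest[OF ne])
        fix q assume q: "q \<in> C"
        obtain m where m: "m \<in> C" "m \<le> q" "m \<le> r"
          using chain[OF q r] q r by auto
        have "?m (x + y) \<le> m (x + y)" by (rule low[OF m(1)])
        also have "\<dots> \<le> m x + m y" using sub[OF m(1)] sublinear_add by blast
        also have "\<dots> \<le> q x + r y" using m by (auto simp: le_fun_def intro: add_mono)
        finally show "?m (x + y) - r y \<le> q x" by simp
      qed
      then show "?m (x + y) - ?m x \<le> r y" by simp
    qed
    then show "?m (x + y) \<le> ?m x + ?m y" by simp
  next
    have "(\<lambda>q. q 0) ` C = {0}" using ne sub sublinear_zero by fastforce
    then show "?m 0 = 0" by simp
  next
    fix t :: real and x assume t: "t > 0"
    have "?m (t *\<^sub>R x) / t \<le> ?m x"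
    proof (rule cINF_greatest[OF ne])
      fix q assume q: "q \<in> C"
      have "?m (t *\<^sub>R x) \<le> t * q x"
        using low[OF q, of "t *\<^sub>R x"] sublinear_scale[of q t x] sub[OF q] t by simp
      then show "?m (t *\<^sub>R x) / t \<le> q x" using t by (simp add: field_simps)
    qed
    then show "?m (t *\<^sub>R x) \<le> t * ?m x" using t by (simp add: field_simps)
  qed
qed

text \<open>Zorn's lemma for the reversed pointwise order: a nonempty chain is bounded by its
  pointwise infimum, the empty one by \<open>p\<close>.\<close>

lemma minimal_sublinear_exists:
  assumes p: "sublinear p"
  obtains q where "sublinear q" "q \<le> p" "\<And>r. sublinear r \<Longrightarrow> r \<le> q \<Longrightarrow> r = q"
proof -
  let ?S = "{q. sublinear q \<and> q \<le> p}"
  have "\<exists>m\<in>?S. \<forall>r\<in>?S. m \<ge> r \<longrightarrow> r = m"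
  proof (rule predicate_Zorn)
    show "partial_order_on ?S (relation_of (\<ge>) ?S)"
      by (rule partial_order_on_relation_ofI) auto
    fix C assume C: "C \<in> Chains (relation_of (\<ge>) ?S)"
    have sub: "sublinear q \<and> q \<le> p" if "q \<in> C" for q
      using C that unfolding Chains_def relation_of_def by auto
    have chain: "q \<le> r \<or> r \<le> q" if "q \<in> C" "r \<in> C" for q r
      using C that unfolding Chains_def relation_of_def by auto
    show "\<exists>u\<in>?S. \<forall>a\<in>C. a \<ge> u"
    proof (cases "C = {}")
      case False
      have inf: "sublinear (\<lambda>x. INF q\<in>C. q x)"
        by (rule sublinear_INF_chain(1)[OF False sub p chain])
      have "(\<lambda>x. INF q\<in>C. q x) \<le> q" if "q \<in> C" for q
        using sublinear_INF_chain(2)[OF False sub p chain that] by (simp add: le_fun_def)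
      moreover from this have "(\<lambda>x. INF q\<in>C. q x) \<le> p"
        using False sub by (metis all_not_in_conv order_trans)
      ultimately show ?thesis using inf by blast
    qed (use p in auto)
  qed
  then obtain m where m: "m \<in> ?S" "\<And>r. r \<in> ?S \<Longrightarrow> m \<ge> r \<Longrightarrow> r = m"
    by blast
  show ?thesis
  proof (rule that)
    fix r assume "sublinear r" "r \<le> m"
    then show "r = m" using m by (metis mem_Collect_eq order_trans)
  qed (use m(1) in auto)
qed

theorem Hahn_Banach_sublinear:
  assumes p: "sublinear (p :: 'a::real_vector \<Rightarrow> real)"
  obtains w where "linear w" "\<And>x. w x \<le> p x" "w x0 = p x0"
proof -
  obtain q where q: "sublinear q" "q \<le> tilt p x0"
    and min: "\<And>r. sublinear r \<Longrightarrow> r \<le> q \<Longrightarrow> r = q"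
    using minimal_sublinear_exists[OF sublinear_tilt[OF p]] by blast
  \<comment> \<open>By minimality \<open>q\<close> equals its tilt in direction \<open>y\<close>;
    the parameter 1 in the infimum then gives superadditivity.\<close>
  have superadd: "q x + q y \<le> q (x + y)" for x y
  proof -
    have "tilt q y \<le> q"
      using tilt_le[OF q(1), of 0 y] by (simp add: le_fun_def)
    then have "tilt q y = q" by (intro min sublinear_tilt[OF q(1)])
    then have "q x \<le> q (x + 1 *\<^sub>R y) - 1 * q y"
      using tilt_le[OF q(1), of 1 y x] by simp
    then show ?thesis by simp
  qed
  have add: "q (x + y) = q x + q y" for x y
    using superadd[of x y] sublinear_add[OF q(1), of x y] by simp
  have neg: "q (- x) = - q x" for x
    using add[of x "- x"] sublinear_zero[OF q(1)] by simp
  have lin: "linear q"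
  proof (rule linearI[OF add])
    fix t :: real and x
    show "q (t *\<^sub>R x) = t *\<^sub>R q x"
    proof (cases "t \<ge> 0")
      case False
      have "q (t *\<^sub>R x) = - q ((- t) *\<^sub>R x)" using neg[of "t *\<^sub>R x"] by simp
      also have "\<dots> = t * q x" using False by (subst sublinear_scale[OF q(1)]) auto
      finally show ?thesis by simp
    qed (simp add: sublinear_scale[OF q(1)])
  qed
  have le: "q x \<le> p x" for x
    using q(2) tilt_le[OF p, of 0 x0 x] by (simp add: le_fun_def) (metis order_trans)
  \<comment> \<open>The parameter 1 in the tilt at \<open>- x0\<close> leaves
    \<open>p 0 - p x0\<close>.\<close>
  have "q (- x0) \<le> - p x0"
    using q(2) tilt_le[OF p, of 1 x0 "- x0"] sublinear_zero[OF p]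
    by (simp add: le_fun_def) (metis order_trans)
  then have "p x0 \<le> q x0" by (simp add: neg)
  then show ?thesis using that[OF lin] le by (simp add: antisym)
qed

section \<open>Norming functionals and the canonical embedding into the bidual\<close>

lemma sublinear_norm: "sublinear norm"
  unfolding sublinear_def by (simp add: norm_triangle_ineq)

lemma norming_functional:
  obtains f :: "'a::real_normed_vector \<Rightarrow>\<^sub>L real" where "norm f \<le> 1" "blinfun_apply f x = norm x"
proof -
  obtain w :: "'a \<Rightarrow> real" where w: "linear w" "\<And>y. w y \<le> norm y" "w x = norm x"
    using Hahn_Banach_sublinear[OF sublinear_norm] by blast
  have bound: "\<bar>w y\<bar> \<le> norm y" for y
    using w(2)[of y] w(2)[of "- y"] linear_neg[OF w(1), of y] by simp
  have bl: "bounded_linear w"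
    by (rule bounded_linear_intro[where K = 1])
      (use bound in \<open>auto simp: linear_add[OF w(1)] linear_scale[OF w(1)]\<close>)
  show ?thesis
    by (rule that[of "Blinfun w"])
      (use bound w(3) in \<open>auto simp: bounded_linear_Blinfun_apply[OF bl] intro!: norm_blinfun_bound\<close>)
qed

lemma norm_bidual_embedding: "norm (bidual_embedding x) = norm x"
proof (rule antisym)
  show "norm (bidual_embedding x) \<le> norm x"
  proof (rule norm_blinfun_bound)
    show "norm (blinfun_apply (bidual_embedding x) f) \<le> norm x * norm f" for f
      unfolding bidual_embedding.rep_eq by (subst mult.commute) (rule norm_blinfun)
  qed simp
  obtain f :: "'a \<Rightarrow>\<^sub>L real" where f: "norm f \<le> 1" "blinfun_apply f x = norm x"
    by (rule norming_functional)
  have "norm x = blinfun_apply (bidual_embedding x) f"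
    by (simp add: bidual_embedding.rep_eq f)
  also have "\<dots> \<le> norm (bidual_embedding x) * norm f"
    using norm_blinfun[of "bidual_embedding x" f] by simp
  also have "\<dots> \<le> norm (bidual_embedding x)"
    using mult_left_mono[OF f(1), of "norm (bidual_embedding x)"] by simp
  finally show "norm x \<le> norm (bidual_embedding x)" .
qed

lemma linear_bidual_embedding: "linear bidual_embedding"
  by (rule linearI; rule blinfun_eqI)
    (simp_all add: bidual_embedding.rep_eq blinfun.bilinear_simps)

text \<open>An isometric linear image of a complete space is complete. Closedness turns a functional
  missed by the embedding into one at positive distance from its range.\<close>

lemma closed_range_bidual_embedding:
  "closed (range (bidual_embedding :: 'a::banach \<Rightarrow> _))"
proof -
  have bl: "bounded_linear (bidual_embedding :: 'a \<Rightarrow> _)"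
    by (rule bounded_linear_intro[where K = 1])
      (auto simp: norm_bidual_embedding linear_add[OF linear_bidual_embedding]
        linear_scale[OF linear_bidual_embedding])
  have "complete (bidual_embedding ` (UNIV :: 'a set))"
    by (rule complete_isometric_image[where e = 1, OF _ _ bl])
      (auto simp: norm_bidual_embedding complete_UNIV)
  then show ?thesis by (rule complete_imp_closed)
qed

section \<open>Sequences witnessing nonreflexivity\<close>

lemma norm_blinfun_real_le:
  fixes g :: "'a::real_normed_vector \<Rightarrow>\<^sub>L real"
  assumes "\<And>y. norm y \<le> 1 \<Longrightarrow> blinfun_apply g y \<le> C"
  shows "norm g \<le> C"
proof -
  have C: "C \<ge> 0" using assms[of 0] by simp
  have le: "blinfun_apply g x \<le> C * norm x" for x
  proof (cases "x = 0")
    case False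
    have "blinfun_apply g (x /\<^sub>R norm x) \<le> C" by (rule assms) (simp add: False)
    then show ?thesis using False by (simp add: blinfun.scaleR_right field_simps)
  qed simp
  show ?thesis
  proof (rule norm_blinfun_bound[OF C])
    fix x show "norm (blinfun_apply g x) \<le> C * norm x"
      using le[of x] le[of "- x"] by (simp add: blinfun.minus_right abs_le_iff)
  qed
qed

text \<open>Helly's theorem. A near-minimiser of the squared distance from
  \<open>c\<close> to the image of the unit ball yields the functional \<open>a = c - f y\<^sub>0\<close> violating the
  hypothesis, so no separation theorem is needed.\<close>

lemma Helly_approx:
  fixes c :: "('a::real_normed_vector \<Rightarrow>\<^sub>L real) \<Rightarrow> real"
  assumes fin: "finite A"
    and le: "\<And>a. (\<Sum>f\<in>A. a f * c f) \<le> norm (\<Sum>f\<in>A. a f *\<^sub>R f)"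
    and e: "e > 0"
  obtains y where "norm y \<le> 1" "\<And>f. f \<in> A \<Longrightarrow> \<bar>c f - blinfun_apply f y\<bar> < e"
proof -
  define D where "D y = (\<Sum>f\<in>A. (c f - blinfun_apply f y)\<^sup>2)" for y
  define d where "d = (INF y\<in>cball 0 1. D y)"
  have D0: "D y \<ge> 0" for y unfolding D_def by (intro sum_nonneg) simp
  have bdd: "bdd_below (D ` cball 0 1)"
    by (rule bdd_belowI2[where m = 0]) (rule D0)
  have dle: "d \<le> D y" if "norm y \<le> 1" for y
    unfolding d_def by (rule cINF_lower[OF bdd]) (use that in simp)
  have near: "\<exists>y. norm y \<le> 1 \<and> D y < d + r" if "r > 0" for r
  proof -
    have "Inf (D ` cball 0 1) < d + r" using that by (simp add: d_def)
    then obtain z where "z \<in> D ` cball 0 1" "z < d + r"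
      using cInf_lessD[of "D ` cball 0 1" "d + r"] by auto
    then show ?thesis by auto
  qed
  have "d \<le> 0"
  proof (rule ccontr)
    assume "\<not> d \<le> 0"
    then have d: "d > 0" by simp
    \<comment> \<open>\<open>M\<close> bounds the sum of the squares of \<open>f y - f y0\<close>
      over the unit ball; the summand 1 makes it positive.\<close>
    define M where "M = (\<Sum>f\<in>A. (2 * norm f)\<^sup>2) + 1"
    have M: "M > 0" unfolding M_def by (intro add_nonneg_pos sum_nonneg) simp_all
    \<comment> \<open>The step length keeps the moved point on a segment in the ball and the
      quadratic term \<open>t\<^sup>2 * M\<close> at most \<open>t * d\<close>.\<close>
    define t where "t = min 1 (d / M)"
    have t: "t > 0" "t \<le> 1" "t * M \<le> d" using d M by (auto simp: t_def min_def field_simps)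
    obtain y0 where y0: "norm y0 \<le> 1" "D y0 < d + t * d / 2"
      using near[of "t * d / 2"] t d by auto
    define v where "v f = c f - blinfun_apply f y0" for f
    define g where "g = (\<Sum>f\<in>A. v f *\<^sub>R f)"
    have gapp: "blinfun_apply g y = (\<Sum>f\<in>A. v f * blinfun_apply f y)" for y
      by (simp add: g_def blinfun.sum_left blinfun.scaleR_left)
    \<comment> \<open>First-order condition: moving from \<open>y0\<close> towards any
      \<open>y\<close> in the ball cannot bring \<open>D\<close> below \<open>d\<close>, so the
      linear term is at most the near-minimality error plus the quadratic term.\<close>
    have "norm g \<le> blinfun_apply g y0 + 3 * d / 4"
    proof (rule norm_blinfun_real_le)
      fix y :: 'a assume y: "norm y \<le> 1"
      define u where "u f = blinfun_apply f y - blinfun_apply f y0" for f :: "'a \<Rightarrow>\<^sub>L real"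
      have uM: "(\<Sum>f\<in>A. (u f)\<^sup>2) \<le> M"
      proof -
        have "(u f)\<^sup>2 \<le> (2 * norm f)\<^sup>2" for f
        proof -
          have "\<bar>blinfun_apply f z\<bar> \<le> norm f" if "norm z \<le> 1" for z
            using norm_blinfun[of f z] mult_left_mono[OF that norm_ge_zero[of f]] by simp
          from this[OF y] this[OF y0(1)] have "\<bar>u f\<bar> \<le> 2 * norm f" unfolding u_def by linarith
          then show ?thesis by (metis abs_ge_zero power2_abs power_mono)
        qed
        then have "(\<Sum>f\<in>A. (u f)\<^sup>2) \<le> (\<Sum>f\<in>A. (2 * norm f)\<^sup>2)" by (intro sum_mono)
        then show ?thesis by (simp add: M_def)
      qed
      have "norm ((1 - t) *\<^sub>R y0 + t *\<^sub>R y) \<le> 1"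
      proof -
        have "norm ((1 - t) *\<^sub>R y0 + t *\<^sub>R y) \<le> (1 - t) * norm y0 + t * norm y"
          by (rule norm_triangle_le) (use t in simp)
        also have "\<dots> \<le> (1 - t) * 1 + t * 1"
          using t y y0(1) by (intro add_mono mult_left_mono) auto
        finally show ?thesis by simp
      qed
      then have "d \<le> D ((1 - t) *\<^sub>R y0 + t *\<^sub>R y)" by (rule dle)
      also have "\<dots> = (\<Sum>f\<in>A. (v f)\<^sup>2 - 2 * t * (v f * u f) + t\<^sup>2 * (u f)\<^sup>2)"
        unfolding D_def v_def u_def
        unfolding blinfun.add_right blinfun.scaleR_right
        by (intro sum.cong refl) (simp add: power2_eq_square algebra_simps)
      also have "\<dots> = D y0 - 2 * t * (\<Sum>f\<in>A. v f * u f) + t\<^sup>2 * (\<Sum>f\<in>A. (u f)\<^sup>2)"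
        by (simp add: D_def v_def sum.distrib sum_subtractf sum_distrib_left)
      finally have "2 * t * (\<Sum>f\<in>A. v f * u f) \<le> t * d / 2 + t\<^sup>2 * (\<Sum>f\<in>A. (u f)\<^sup>2)"
        using y0(2) by simp
      also have "\<dots> \<le> t * d / 2 + t\<^sup>2 * M"
        using uM by (intro add_left_mono mult_left_mono) auto
      also have "\<dots> = t * (d / 2 + t * M)" by (simp add: power2_eq_square algebra_simps)
      also have "\<dots> \<le> t * (d / 2 + d)" using t by (intro mult_left_mono) auto
      finally have "t * (2 * (\<Sum>f\<in>A. v f * u f)) \<le> t * (d / 2 + d)" by (simp add: mult_ac)
      then have "(\<Sum>f\<in>A. v f * u f) \<le> 3 * d / 4" using t(1) by simp
      moreover have "(\<Sum>f\<in>A. v f * u f) = blinfun_apply g y - blinfun_apply g y0"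
        by (simp add: gapp u_def algebra_simps sum_subtractf)
      ultimately show "blinfun_apply g y \<le> blinfun_apply g y0 + 3 * d / 4" by simp
    qed
    moreover have "(\<Sum>f\<in>A. v f * c f) \<le> norm g"
      unfolding g_def by (rule le)
    \<comment> \<open>Since the sum of \<open>v f * c f\<close> is at most \<open>norm g\<close>,
      this identity yields \<open>D y0 \<le> 3 * d / 4\<close>, below the infimum
      \<open>d\<close>.\<close>
    moreover have "D y0 = (\<Sum>f\<in>A. v f * c f) - blinfun_apply g y0"
      by (simp add: D_def gapp v_def power2_eq_square algebra_simps flip: sum_subtractf)
    ultimately have "D y0 \<le> 3 * d / 4" by simp
    with dle[OF y0(1)] d show False by simp
  qed
  obtain y where y: "norm y \<le> 1" "D y < d + e\<^sup>2" using near[of "e\<^sup>2"] e by auto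
  show ?thesis
  proof (rule that[OF y(1)])
    fix f assume f: "f \<in> A"
    have "(c f - blinfun_apply f y)\<^sup>2 \<le> D y"
      unfolding D_def by (rule member_le_sum[OF f]) (use fin in auto)
    also have "\<dots> < e\<^sup>2" using y(2) \<open>d \<le> 0\<close> by simp
    finally show "\<bar>c f - blinfun_apply f y\<bar> < e"
      using e abs_le_square_iff[of e "c f - blinfun_apply f y"] by simp
  qed
qed

lemma nonreflexive_far_functional:
  assumes "\<not> reflexive_space TYPE('a::banach)"
  obtains F :: "('a::banach \<Rightarrow>\<^sub>L real) \<Rightarrow>\<^sub>L real" and d
  where "norm F \<le> 1" "d > 0" "\<And>x. d \<le> norm (F - bidual_embedding x)"
proof -
  let ?R = "range (bidual_embedding :: 'a \<Rightarrow> _)"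
  obtain F :: "('a \<Rightarrow>\<^sub>L real) \<Rightarrow>\<^sub>L real" where F: "F \<notin> ?R"
    using assms by (auto simp: reflexive_space_def)
  have sub: "subspace ?R"
    by (rule linear_subspace_image[OF linear_bidual_embedding subspace_UNIV])
  have F0: "F \<noteq> 0" using F subspace_0[OF sub] by auto
  let ?G = "F /\<^sub>R norm F"
  have G: "?G \<notin> ?R"
    using F F0 subspace_scale[OF sub, of ?G "norm F"] by auto
  have "open (- ?R)" by (intro open_Compl closed_range_bidual_embedding)
  then obtain d where d: "d > 0" "ball ?G d \<subseteq> - ?R"
    using G openE[of "- ?R" ?G] by auto
  have "d \<le> norm (?G - bidual_embedding x)" for x
  proof (rule ccontr)
    assume "\<not> d \<le> norm (?G - bidual_embedding x)"
    then have "bidual_embedding x \<in> ball ?G d" by (simp add: dist_norm)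
    with d(2) show False by auto
  qed
  then show ?thesis using that[of ?G d] d(1) F0 by simp
qed

text \<open>The pairs are built alternately: \<open>h n\<close> has \<open>F\<close>-value near
  \<open>d\<close> and almost vanishes at all earlier points, then \<open>x n\<close> imitates
  \<open>F\<close> on \<open>h 0, ..., h n\<close>. With errors below \<open>d/4\<close> the two
  cases are separated by \<open>d/2\<close> and \<open>d/4\<close>, so \<theta> is
  \<open>d/4\<close>.\<close>

lemma nonreflexive_sequences:
  assumes "\<not> reflexive_space TYPE('a::banach)"
  obtains \<theta> and h :: "nat \<Rightarrow> 'a::banach \<Rightarrow>\<^sub>L real" and x :: "nat \<Rightarrow> 'a"
  where "\<theta> > 0" "\<And>n. norm (h n) \<le> 1" "\<And>n. norm (x n) \<le> 1"
    "\<And>i n. i \<le> n \<Longrightarrow> blinfun_apply (h i) (x n) \<ge> 2 * \<theta>"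
    "\<And>i n. n < i \<Longrightarrow> blinfun_apply (h i) (x n) \<le> \<theta>"
proof -
  let ?J = "bidual_embedding :: 'a \<Rightarrow> _"
  obtain F :: "('a \<Rightarrow>\<^sub>L real) \<Rightarrow>\<^sub>L real" and d
    where F: "norm F \<le> 1" and d: "d > 0" "\<And>x. d \<le> norm (F - ?J x)"
    using nonreflexive_far_functional[OF assms] by blast
  have d4: "d/4 > 0" using d(1) by simp
  \<comment> \<open>Helly's theorem one level up: prescribe the value \<open>d\<close> at
    \<open>F\<close> and 0 at the embedded points. Its hypothesis is the distance estimate, scaled
    by the coefficient of \<open>F\<close> when that is positive.\<close>
  have functional: "\<exists>h. norm h \<le> 1 \<and> \<bar>d - blinfun_apply F h\<bar> < d/4 \<and>
      (\<forall>x\<in>X. \<bar>blinfun_apply h x\<bar> < d/4)" if X: "finite X" for X :: "'a set"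
  proof -
    have FX: "F \<notin> ?J ` X"
    proof
      assume "F \<in> ?J ` X"
      then obtain x where "F = ?J x" by blast
      with d(2)[of x] d(1) show False by simp
    qed
    let ?c = "\<lambda>G. if G = F then d else 0"
    have "(\<Sum>G\<in>insert F (?J ` X). a G * ?c G) \<le> norm (\<Sum>G\<in>insert F (?J ` X). a G *\<^sub>R G)" for a
    proof -
      have "(\<Sum>G\<in>?J ` X. a G * ?c G) = 0"
        by (rule sum.neutral) (use FX in auto)
      then have l: "(\<Sum>G\<in>insert F (?J ` X). a G * ?c G) = a F * d"
        using X FX by (subst sum.insert) auto
      have sub: "subspace (range ?J)"
        by (rule linear_subspace_image[OF linear_bidual_embedding subspace_UNIV])
      have "(\<Sum>G\<in>?J ` X. a G *\<^sub>R G) \<in> range ?J"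
        by (rule subspace_sum[OF sub]) (use subspace_scale[OF sub] in auto)
      then obtain z where z: "(\<Sum>G\<in>?J ` X. a G *\<^sub>R G) = ?J z" by auto
      have r: "(\<Sum>G\<in>insert F (?J ` X). a G *\<^sub>R G) = a F *\<^sub>R F + ?J z"
        using X FX z by (subst sum.insert) auto
      have "a F * d \<le> norm (a F *\<^sub>R F + ?J z)"
      proof (cases "a F > 0")
        case True
        have "a F * d \<le> a F * norm (F - ?J ((- 1 / a F) *\<^sub>R z))"
          using True d by (intro mult_left_mono) auto
        also have "\<dots> = norm (a F *\<^sub>R (F - ?J ((- 1 / a F) *\<^sub>R z)))" using True by simp
        also have "a F *\<^sub>R (F - ?J ((- 1 / a F) *\<^sub>R z)) = a F *\<^sub>R F + ?J z"
          unfolding linear_scale[OF linear_bidual_embedding] using True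
          by (simp add: scaleR_add_right)
        finally show ?thesis .
      next
        case False
        then have "a F * d \<le> 0" using d(1) by (simp add: mult_le_0_iff)
        then show ?thesis using norm_ge_zero order_trans by blast
      qed
      then show ?thesis by (simp only: l r)
    qed
    then obtain h where "norm h \<le> 1"
      and h: "\<And>G. G \<in> insert F (?J ` X) \<Longrightarrow> \<bar>?c G - blinfun_apply G h\<bar> < d/4"
      by (rule Helly_approx[where c = ?c, OF finite.insertI[OF finite_imageI[OF X]] _ d4]) blast
    have "\<bar>blinfun_apply h x\<bar> < d/4" if "x \<in> X" for x
    proof -
      have "?J x \<noteq> F" using that FX by blast
      then show ?thesis using h[of "?J x"] that by (simp add: bidual_embedding.rep_eq)
    qed
    with h[of F] \<open>norm h \<le> 1\<close> show ?thesis by auto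
  qed
  \<comment> \<open>Helly's theorem for the values of \<open>F\<close>, whose hypothesis is just
    \<open>norm F \<le> 1\<close>; this is the density of the ball in the bidual ball.\<close>
  have point: "\<exists>x. norm x \<le> 1 \<and> (\<forall>h\<in>H. \<bar>blinfun_apply F h - blinfun_apply h x\<bar> < d/4)"
    if H: "finite H" for H
  proof -
    have "(\<Sum>h\<in>H. a h * blinfun_apply F h) \<le> norm (\<Sum>h\<in>H. a h *\<^sub>R h)" for a
    proof -
      have "(\<Sum>h\<in>H. a h * blinfun_apply F h) = blinfun_apply F (\<Sum>h\<in>H. a h *\<^sub>R h)"
        by (simp add: blinfun.sum_right blinfun.scaleR_right)
      also have "\<dots> \<le> norm F * norm (\<Sum>h\<in>H. a h *\<^sub>R h)"
        using norm_blinfun[of F "\<Sum>h\<in>H. a h *\<^sub>R h"] by simp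
      also have "\<dots> \<le> 1 * norm (\<Sum>h\<in>H. a h *\<^sub>R h)"
        using F by (intro mult_right_mono) auto
      finally show ?thesis by simp
    qed
    then obtain x where "norm x \<le> 1" "\<And>h. h \<in> H \<Longrightarrow> \<bar>blinfun_apply F h - blinfun_apply h x\<bar> < d/4"
      by (rule Helly_approx[where c = "blinfun_apply F", OF H _ d4]) blast
    then show ?thesis by blast
  qed
  \<comment> \<open>The state of the recursion is the list of all pairs so far, newest first,
    because each new pair is constrained by every earlier one.\<close>
  define P where "P s \<longleftrightarrow> (\<forall>(h, x) \<in> set s. norm h \<le> 1 \<and> norm x \<le> 1 \<and> \<bar>d - blinfun_apply F h\<bar> < d/4)"
    for s :: "(('a \<Rightarrow>\<^sub>L real) \<times> 'a) list"
  define Q where "Q s s' \<longleftrightarrow> (\<exists>h x. s' = (h, x) # s \<and> blinfun_apply h x \<ge> d/2 \<and>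
      (\<forall>(h', x') \<in> set s. blinfun_apply h x' \<le> d/4 \<and> blinfun_apply h' x \<ge> d/2))"
    for s s' :: "(('a \<Rightarrow>\<^sub>L real) \<times> 'a) list"
  have "\<exists>s. \<forall>n. P (s n) \<and> Q (s n) (s (Suc n))"
  proof (rule dependent_nat_choice)
    show "\<exists>s. P s" by (rule exI[of _ "[]"]) (simp add: P_def)
    fix s :: "(('a \<Rightarrow>\<^sub>L real) \<times> 'a) list" assume s: "P s"
    obtain h where h: "norm h \<le> 1" "\<bar>d - blinfun_apply F h\<bar> < d/4"
      "\<And>x. x \<in> snd ` set s \<Longrightarrow> \<bar>blinfun_apply h x\<bar> < d/4"
      using functional[of "snd ` set s"] by auto
    obtain x where x: "norm x \<le> 1"
      "\<And>h'. h' \<in> insert h (fst ` set s) \<Longrightarrow> \<bar>blinfun_apply F h' - blinfun_apply h' x\<bar> < d/4"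
      using point[of "insert h (fst ` set s)"] by auto
    have big: "blinfun_apply h' x \<ge> d/2" if "h' \<in> insert h (fst ` set s)" for h'
    proof -
      have "\<bar>d - blinfun_apply F h'\<bar> < d/4" using that h(2) s by (auto simp: P_def)
      with x(2)[OF that] show ?thesis by linarith
    qed
    have small: "blinfun_apply h x' \<le> d/4" if "x' \<in> snd ` set s" for x'
      using h(3)[OF that] by linarith
    have "P ((h, x) # s)" using s h x(1) by (simp add: P_def)
    moreover have "Q s ((h, x) # s)"
    proof -
      have "blinfun_apply h x' \<le> d/4 \<and> blinfun_apply h' x \<ge> d/2" if "(h', x') \<in> set s" for h' x'
      proof
        have "h' \<in> fst ` set s" "x' \<in> snd ` set s" using that by (auto intro: rev_image_eqI)
        then show "blinfun_apply h x' \<le> d/4" "blinfun_apply h' x \<ge> d/2"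
          using small big by auto
      qed
      then show ?thesis using big unfolding Q_def by blast
    qed
    ultimately show "\<exists>s'. P s' \<and> Q s s'" by blast
  qed
  then obtain s where P: "\<And>n. P (s n)" and Q: "\<And>n. Q (s n) (s (Suc n))" by blast
  define h where "h n = fst (hd (s (Suc n)))" for n
  define x where "x n = snd (hd (s (Suc n)))" for n
  have step: "s (Suc n) = (h n, x n) # s n" "blinfun_apply (h n) (x n) \<ge> d/2"
    "\<And>h' x'. (h', x') \<in> set (s n) \<Longrightarrow> blinfun_apply (h n) x' \<le> d/4 \<and> blinfun_apply h' (x n) \<ge> d/2" for n
    using Q[of n] by (auto simp: Q_def h_def x_def)
  have mem: "(h i, x i) \<in> set (s n)" if "i < n" for i n
    using that by (induction n) (auto simp: step(1) less_Suc_eq)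
  show ?thesis
  proof (rule that[of "d/4" h x])
    show "norm (h n) \<le> 1" "norm (x n) \<le> 1" for n
      using P[of "Suc n"] mem[of n "Suc n"] by (auto simp: P_def)
    show "2 * (d/4) \<le> blinfun_apply (h i) (x n)" if "i \<le> n" for i n
      using step(2)[of n] step(3)[OF mem, of i n] that by (cases "i = n") auto
    show "blinfun_apply (h i) (x n) \<le> d/4" if "n < i" for i n
      using step(3)[OF mem[OF that]] by simp
  qed (use d in simp)
qed

section \<open>Upper limits of nested convex sets\<close>

text \<open>
  A decreasing sequence \<open>K\<close> of convex subsets of the dual ball plays the role of a sequence of
  functionals: \<open>upper_limit K\<close> is its limit superior, \<open>\<lambda>x. - upper_limit K (- x)\<close> its limit
  inferior.
\<close>

definition nested :: "(nat \<Rightarrow> ('a::real_normed_vector \<Rightarrow>\<^sub>L real) set) \<Rightarrow> bool" where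
  "nested K \<longleftrightarrow> (\<forall>m n. m \<le> n \<longrightarrow> K n \<subseteq> K m) \<and>
     (\<forall>n. convex (K n) \<and> K n \<noteq> {} \<and> K n \<subseteq> cball 0 1)"

definition upper_limit ::
    "(nat \<Rightarrow> ('a::real_normed_vector \<Rightarrow>\<^sub>L real) set) \<Rightarrow> 'a \<Rightarrow> real" where
  "upper_limit K x = (INF n. SUP f\<in>K n. blinfun_apply f x)"

text \<open>The upper limit is not linear, so \<open>f - s * upper_limit K\<close> is no element of
  the dual. Keeping \<open>s\<close> as a second variable makes the gap sublinear in the pair
  \<open>(f, s)\<close>.\<close>

definition gap ::
    "(nat \<Rightarrow> ('a::real_normed_vector \<Rightarrow>\<^sub>L real) set) \<Rightarrow> ('a \<Rightarrow>\<^sub>L real) \<Rightarrow> real \<Rightarrow> real" where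
  "gap K f s = (SUP x\<in>cball 0 1. blinfun_apply f x - s * upper_limit K x)"

lemma nestedD:
  assumes "nested K"
  shows "m \<le> n \<Longrightarrow> K n \<subseteq> K m" "convex (K n)" "K n \<noteq> {}" "f \<in> K n \<Longrightarrow> norm f \<le> 1"
  using assms by (auto simp: nested_def subset_iff)

lemma blinfun_le_norm:
  fixes f :: "'a::real_normed_vector \<Rightarrow>\<^sub>L real"
  assumes "norm f \<le> 1"
  shows "\<bar>blinfun_apply f x\<bar> \<le> norm x"
  using norm_blinfun[of f x] mult_right_mono[OF assms norm_ge_zero[of x]] by simp

lemma convex_blinfun_halfspace:
  fixes x :: "'a::real_normed_vector"
  shows "convex {g :: 'a \<Rightarrow>\<^sub>L real. blinfun_apply g x \<le> c}"
proof (rule convexI)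
  fix g g' :: "'a \<Rightarrow>\<^sub>L real" and s t :: real
  assume "g \<in> {g. blinfun_apply g x \<le> c}" "g' \<in> {g. blinfun_apply g x \<le> c}"
    and "0 \<le> s" "0 \<le> t" "s + t = 1"
  then have "s * blinfun_apply g x + t * blinfun_apply g' x \<le> c"
    by (intro convex_bound_le) auto
  then show "s *\<^sub>R g + t *\<^sub>R g' \<in> {g. blinfun_apply g x \<le> c}"
    by (simp add: blinfun.add_left blinfun.scaleR_left)
qed

lemma nested_convex_hull:
  assumes "\<And>i. norm (g i) \<le> 1"
  shows "nested (\<lambda>n. convex hull (g ` {n..}))"
  unfolding nested_def
proof (intro conjI allI impI)
  show "convex hull (g ` {n..}) \<subseteq> convex hull (g ` {m..})" if "m \<le> n" for m n
    by (rule hull_mono) (use that in auto)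
  show "convex hull (g ` {n..}) \<subseteq> cball 0 1" for n
    by (rule hull_minimal) (use assms in auto)
qed auto

lemma SUP_bounds:
  assumes "nested K"
  shows "bdd_above ((\<lambda>f. blinfun_apply f x) ` K n)"
    and "- norm x \<le> (SUP f\<in>K n. blinfun_apply f x)"
proof -
  have b: "\<bar>blinfun_apply f x\<bar> \<le> norm x" if "f \<in> K n" for f
    by (rule blinfun_le_norm[OF nestedD(4)[OF assms that]])
  show bdd: "bdd_above ((\<lambda>f. blinfun_apply f x) ` K n)"
    by (rule bdd_aboveI2[where M = "norm x"]) (use b abs_le_D1 in blast)
  obtain f where f: "f \<in> K n" using nestedD(3)[OF assms] by blast
  show "- norm x \<le> (SUP f\<in>K n. blinfun_apply f x)"
    by (rule cSUP_upper2[OF bdd f]) (use b[OF f] in linarith)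
qed

lemma upper_limit_le:
  assumes "nested K"
  shows "upper_limit K x \<le> (SUP f\<in>K n. blinfun_apply f x)"
  unfolding upper_limit_def
  by (rule cINF_lower) (auto intro!: bdd_belowI2[where m = "- norm x"] SUP_bounds[OF assms])

lemma upper_limit_leI:
  assumes "nested K" "\<And>f. f \<in> K n \<Longrightarrow> blinfun_apply f x \<le> c"
  shows "upper_limit K x \<le> c"
  using upper_limit_le[OF assms(1)] cSUP_least[OF nestedD(3)[OF assms(1)] assms(2)]
  by (rule order_trans)

lemma upper_limit_geI:
  assumes "nested K" "\<And>n. \<exists>f\<in>K n. c \<le> blinfun_apply f x"
  shows "c \<le> upper_limit K x"
  unfolding upper_limit_def
proof (rule cINF_greatest)
  fix n
  obtain f where "f \<in> K n" "c \<le> blinfun_apply f x" using assms(2) by blast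
  then show "c \<le> (SUP f\<in>K n. blinfun_apply f x)"
    by (rule cSUP_upper2[OF SUP_bounds(1)[OF assms(1)]])
qed simp

lemma upper_limit_less:
  assumes "nested K" "upper_limit K x < c"
  obtains n where "\<And>f m. m \<ge> n \<Longrightarrow> f \<in> K m \<Longrightarrow> blinfun_apply f x < c"
proof -
  obtain n where n: "(SUP f\<in>K n. blinfun_apply f x) < c"
    using cInf_lessD[of "range (\<lambda>n. SUP f\<in>K n. blinfun_apply f x)" c] assms(2)
    by (auto simp: upper_limit_def)
  show ?thesis
  proof (rule that)
    fix f m assume "m \<ge> n" "f \<in> K m"
    then have "f \<in> K n" using nestedD(1)[OF assms(1)] by blast
    then have "blinfun_apply f x \<le> (SUP f\<in>K n. blinfun_apply f x)"
      by (rule cSUP_upper[OF _ SUP_bounds(1)[OF assms(1)]])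
    with n show "blinfun_apply f x < c" by simp
  qed
qed

lemma abs_upper_limit_le:
  assumes "nested K"
  shows "\<bar>upper_limit K x\<bar> \<le> norm x"
proof (rule abs_leI)
  have b: "\<bar>blinfun_apply f x\<bar> \<le> norm x" if "f \<in> K n" for f n
    by (rule blinfun_le_norm[OF nestedD(4)[OF assms that]])
  show "upper_limit K x \<le> norm x"
    by (rule upper_limit_leI[OF assms, where n = 0]) (use b abs_le_D1 in blast)
  have "- norm x \<le> upper_limit K x"
  proof (rule upper_limit_geI[OF assms])
    fix n
    obtain f where f: "f \<in> K n" using nestedD(3)[OF assms] by blast
    then show "\<exists>f\<in>K n. - norm x \<le> blinfun_apply f x" using b[OF f] by (intro bexI[of _ f]) auto
  qed
  then show "- upper_limit K x \<le> norm x" by simp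
qed

text \<open>Only late stages matter for the upper limit. Inclusion from some stage on is what a
  diagonal sequence of refinements satisfies.\<close>

lemma upper_limit_mono:
  assumes "nested K" "nested K'" "\<And>i. i \<ge> n \<Longrightarrow> K' i \<subseteq> K i"
  shows "upper_limit K' x \<le> upper_limit K x"
proof (rule field_le_epsilon)
  fix e :: real assume "e > 0"
  then obtain m where m: "\<And>f i. i \<ge> m \<Longrightarrow> f \<in> K i \<Longrightarrow> blinfun_apply f x < upper_limit K x + e"
    using upper_limit_less[OF assms(1), of x "upper_limit K x + e"] by auto
  show "upper_limit K' x \<le> upper_limit K x + e"
  proof (rule upper_limit_leI[OF assms(2)])
    fix f assume "f \<in> K' (max m n)"
    then show "blinfun_apply f x \<le> upper_limit K x + e"
      using m[of "max m n" f] assms(3)[of "max m n"] by auto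
  qed
qed

lemma sublinear_upper_limit:
  assumes "nested K"
  shows "sublinear (upper_limit K)"
proof (rule sublinearI)
  fix x y
  show "upper_limit K (x + y) \<le> upper_limit K x + upper_limit K y"
  proof (rule field_le_epsilon)
    fix e :: real assume "e > 0"
    then obtain m n where m: "\<And>f i. i \<ge> m \<Longrightarrow> f \<in> K i \<Longrightarrow> blinfun_apply f x < upper_limit K x + e/2"
      and n: "\<And>f i. i \<ge> n \<Longrightarrow> f \<in> K i \<Longrightarrow> blinfun_apply f y < upper_limit K y + e/2"
      using upper_limit_less[OF assms, of x "upper_limit K x + e/2"]
        upper_limit_less[OF assms, of y "upper_limit K y + e/2"] by (metis half_gt_zero less_add_same_cancel1)
    show "upper_limit K (x + y) \<le> upper_limit K x + upper_limit K y + e"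
    proof (rule upper_limit_leI[OF assms])
      fix f assume "f \<in> K (max m n)"
      then show "blinfun_apply f (x + y) \<le> upper_limit K x + upper_limit K y + e"
        using m[of "max m n" f] n[of "max m n" f] by (simp add: blinfun.add_right)
    qed
  qed
next
  show "upper_limit K 0 = 0" using abs_upper_limit_le[OF assms, of 0] by simp
next
  fix t :: real and x assume t: "t > 0"
  show "upper_limit K (t *\<^sub>R x) \<le> t * upper_limit K x"
  proof (rule field_le_epsilon)
    fix e :: real assume "e > 0"
    then obtain m where m: "\<And>f i. i \<ge> m \<Longrightarrow> f \<in> K i \<Longrightarrow> blinfun_apply f x < upper_limit K x + e / t"
      using upper_limit_less[OF assms, of x "upper_limit K x + e / t"] t by auto
    show "upper_limit K (t *\<^sub>R x) \<le> t * upper_limit K x + e"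
    proof (rule upper_limit_leI[OF assms])
      fix f assume "f \<in> K m"
      then have "t * blinfun_apply f x \<le> t * (upper_limit K x + e / t)"
        using m[of m f] t by (intro mult_left_mono) auto
      then show "blinfun_apply f (t *\<^sub>R x) \<le> t * upper_limit K x + e"
        using t by (simp add: blinfun.scaleR_right distrib_left)
    qed
  qed
qed

section \<open>Sublinearity and monotonicity of the gap\<close>

lemma gap_bdd:
  assumes "nested K" "norm x \<le> 1"
  shows "\<bar>blinfun_apply f x - s * upper_limit K x\<bar> \<le> norm f + \<bar>s\<bar>"
proof -
  have "\<bar>blinfun_apply f x\<bar> \<le> norm f"
    using norm_blinfun[of f x] mult_left_mono[OF assms(2) norm_ge_zero[of f]] by simp
  moreover have "\<bar>s * upper_limit K x\<bar> \<le> \<bar>s\<bar>"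
    using mult_left_mono[of "\<bar>upper_limit K x\<bar>" 1 "\<bar>s\<bar>"] abs_upper_limit_le[OF assms(1), of x] assms(2)
    by (simp add: abs_mult)
  ultimately show ?thesis by linarith
qed

lemma gap_upper:
  assumes "nested K" "norm x \<le> 1"
  shows "blinfun_apply f x - s * upper_limit K x \<le> gap K f s"
  unfolding gap_def
proof (rule cSUP_upper)
  show "bdd_above ((\<lambda>x. blinfun_apply f x - s * upper_limit K x) ` cball 0 1)"
    by (rule bdd_aboveI2[where M = "norm f + \<bar>s\<bar>"])
      (rule abs_le_D1[OF gap_bdd[OF assms(1)]], simp)
qed (use assms in simp)

lemma gap_least:
  assumes "\<And>x. norm x \<le> 1 \<Longrightarrow> blinfun_apply f x - s * upper_limit K x \<le> c"
  shows "gap K f s \<le> c"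
  unfolding gap_def by (rule cSUP_least) (use assms in auto)

lemma sublinear_gap:
  assumes "nested K"
  shows "sublinear (\<lambda>(f, s). gap K f s)"
proof (rule sublinearI)
  fix a b :: "('a \<Rightarrow>\<^sub>L real) \<times> real"
  obtain f s g t where ab: "a = (f, s)" "b = (g, t)" by (cases a, cases b)
  have "gap K (f + g) (s + t) \<le> gap K f s + gap K g t"
    by (rule gap_least)
      (use gap_upper[OF assms, of _ f s] gap_upper[OF assms, of _ g t]
        in \<open>fastforce simp: blinfun.add_left algebra_simps\<close>)
  then show "(case a + b of (f, s) \<Rightarrow> gap K f s)
      \<le> (case a of (f, s) \<Rightarrow> gap K f s) + (case b of (f, s) \<Rightarrow> gap K f s)"
    by (simp add: ab)
next
  show "(case 0 of (f, s) \<Rightarrow> gap K f s) = 0"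
    by (simp add: zero_prod_def gap_def)
next
  fix t :: real and a :: "('a \<Rightarrow>\<^sub>L real) \<times> real" assume t: "t > 0"
  obtain f s where a: "a = (f, s)" by (cases a)
  have "gap K (t *\<^sub>R f) (t * s) \<le> t * gap K f s"
  proof (rule gap_least)
    fix x :: 'a assume "norm x \<le> 1"
    then have "t * (blinfun_apply f x - s * upper_limit K x) \<le> t * gap K f s"
      using gap_upper[OF assms] t by (intro mult_left_mono) auto
    then show "blinfun_apply (t *\<^sub>R f) x - t * s * upper_limit K x \<le> t * gap K f s"
      by (simp add: blinfun.scaleR_left algebra_simps)
  qed
  then show "(case t *\<^sub>R a of (f, s) \<Rightarrow> gap K f s) \<le> t * (case a of (f, s) \<Rightarrow> gap K f s)"
    by (simp add: a)
qed

lemma gap_antimono: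
  assumes "nested K" "nested K'" "\<And>i. i \<ge> n \<Longrightarrow> K' i \<subseteq> K i" "s \<ge> 0"
  shows "gap K f s \<le> gap K' f s"
proof (rule gap_least)
  fix x :: 'a assume x: "norm x \<le> 1"
  have "s * upper_limit K' x \<le> s * upper_limit K x"
    using upper_limit_mono[OF assms(1-3)] assms(4) by (intro mult_left_mono)
  with gap_upper[OF assms(2) x, of f s]
  show "blinfun_apply f x - s * upper_limit K x \<le> gap K' f s" by simp
qed

text \<open>This Lipschitz bound carries estimates of the gap from the countable family
  \<open>e\<close> to its closure.\<close>

lemma gap_add_norm:
  assumes "nested K"
  shows "gap K f s \<le> gap K g s + norm (f - g)"
proof (rule gap_least)
  fix x :: 'a assume x: "norm x \<le> 1"
  have "blinfun_apply (f - g) x \<le> norm (f - g)"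
    using norm_blinfun[of "f - g" x] mult_left_mono[OF x norm_ge_zero[of "f - g"]] by simp
  with gap_upper[OF assms x, of g s]
  show "blinfun_apply f x - s * upper_limit K x \<le> gap K g s + norm (f - g)"
    by (simp add: blinfun.diff_left)
qed

section \<open>James' theorem\<close>

text \<open>Rational combinations, coded as lists of coefficient and index, form a countable family.
  Pryce's lemma controls the closure of a sequence, and this one covers every partial sum formed
  from the \<open>h i\<close>.\<close>

lemma rational_span_dense:
  fixes h :: "nat \<Rightarrow> 'a::real_normed_vector"
  obtains e :: "nat \<Rightarrow> 'a" where "span (range h) \<subseteq> closure (range e)"
proof -
  define comb where "comb qs = (\<Sum>(q, i)\<leftarrow>qs. of_rat q *\<^sub>R h i)" for qs :: "(rat \<times> nat) list"
  have comb_step: "c *\<^sub>R h i + y \<in> closure (range comb)" if y: "y \<in> closure (range comb)" for c i y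
    unfolding closure_approachable
  proof (intro allI impI)
    fix \<epsilon> :: real assume \<epsilon>: "\<epsilon> > 0"
    obtain qs where qs: "dist (comb qs) y < \<epsilon>/2"
      using y \<epsilon> unfolding closure_approachable by (metis half_gt_zero imageE)
    \<comment> \<open>With this precision the coefficient error contributes at most half of
      \<epsilon>; the summand 1 avoids a zero denominator.\<close>
    define r where "r = \<epsilon> / (2 * (norm (h i) + 1))"
    have r: "r > 0" unfolding r_def using \<epsilon> by (intro divide_pos_pos mult_pos_pos) (auto intro: add_nonneg_pos)
    obtain q where q: "c - r < of_rat q" "of_rat q < c + r"
      using of_rat_dense[of "c - r" "c + r"] r by auto
    have "norm (of_rat q *\<^sub>R h i - c *\<^sub>R h i) = \<bar>of_rat q - c\<bar> * norm (h i)"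
      by (metis norm_scaleR scaleR_diff_left)
    also have "\<dots> \<le> r * (norm (h i) + 1)"
      using q by (intro mult_mono) auto
    also have "\<dots> = \<epsilon>/2"
    proof -
      define k where "k = norm (h i) + 1"
      have "k \<noteq> 0" unfolding k_def using norm_ge_zero[of "h i"] by linarith
      then show ?thesis by (simp add: r_def flip: k_def)
    qed
    finally have "norm ((of_rat q *\<^sub>R h i - c *\<^sub>R h i) + (comb qs - y)) < \<epsilon>/2 + \<epsilon>/2"
      using qs by (intro norm_triangle_lt add_le_less_mono) (auto simp: dist_norm)
    then have "dist (comb ((q, i) # qs)) (c *\<^sub>R h i + y) < \<epsilon>"
      by (simp add: dist_norm comb_def algebra_simps)
    then show "\<exists>z\<in>range comb. dist z (c *\<^sub>R h i + y) < \<epsilon>" by blast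
  qed
  have "x \<in> closure (range comb)" if "x \<in> span (range h)" for x
    using that
  proof (induction rule: span_induct_alt)
    case base
    have "comb [] = 0" by (simp add: comb_def)
    then have "0 \<in> range comb" by (metis rangeI)
    then show ?case by (rule subsetD[OF closure_subset])
  next
    case (step c x y)
    then show ?case using comb_step by blast
  qed
  moreover have "range (\<lambda>n. comb (from_nat n)) = comb ` range from_nat"
    by (rule image_image[symmetric])
  then have "range (\<lambda>n. comb (from_nat n)) = range comb" by simp
  ultimately show ?thesis using that[of "\<lambda>n. comb (from_nat n)"] by auto
qed

text \<open>Pryce's lemma, with nested convex sets in place of subsequences: after passing to a
  refinement \<open>K'\<close>, replacing the upper by the lower limit does not increase the gap. The
  refinement nearly maximises the gap of each \<open>e j\<close> at infinitely many stages, because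
  \<open>prod_decode\<close> returns to every index \<open>j\<close>.\<close>

lemma Pryce:
  fixes e :: "nat \<Rightarrow> 'a::real_normed_vector \<Rightarrow>\<^sub>L real"
  assumes K: "nested K"
  obtains K' where "nested K'" "\<And>n. K' n \<subseteq> K n"
    "\<And>f x. f \<in> closure (range e) \<Longrightarrow> norm x \<le> 1 \<Longrightarrow>
      blinfun_apply f x + upper_limit K' (- x) \<le> gap K' f 1"
proof -
  define d where "d k = e (fst (prod_decode k))" for k
  \<comment> \<open>\<open>K2\<close> refines \<open>K1\<close>, and its gap at \<open>d k\<close>
    is within \<open>1 / (k + 1)\<close> of the best among all refinements of
    \<open>K1\<close>.\<close>
  define Q where "Q k K1 K2 \<longleftrightarrow> (\<forall>n. K2 n \<subseteq> K1 n) \<and>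
      (\<forall>L. nested L \<and> (\<forall>n. L n \<subseteq> K1 n) \<longrightarrow> gap L (d k) 1 \<le> gap K2 (d k) 1 + 1 / (real k + 1))"
    for k and K1 K2 :: "nat \<Rightarrow> ('a \<Rightarrow>\<^sub>L real) set"
  have "\<exists>K. \<forall>k. (nested (K k) \<and> (\<forall>n. K k n \<subseteq> K0 n)) \<and> Q k (K k) (K (Suc k))"
    if "nested K0" for K0
  proof (rule dependent_nat_choice)
    show "\<exists>K. nested K \<and> (\<forall>n. K n \<subseteq> K0 n)" using that by blast
    fix K1 k assume K1: "nested K1 \<and> (\<forall>n. K1 n \<subseteq> K0 n)"
    define G where "G = {gap L (d k) 1 | L. nested L \<and> (\<forall>n. L n \<subseteq> K1 n)}"
    have bdd: "bdd_above G"
    proof (rule bdd_aboveI)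
      fix g assume "g \<in> G"
      then obtain L where L: "g = gap L (d k) 1" "nested L" by (auto simp: G_def)
      show "g \<le> norm (d k) + \<bar>1\<bar>"
        unfolding L(1) by (rule gap_least) (use gap_bdd[OF L(2)] abs_le_D1 in blast)
    qed
    have ne: "G \<noteq> {}" using K1 by (auto simp: G_def)
    have "Sup G - 1 / (real k + 1) < Sup G" by simp
    then obtain g where g: "g \<in> G" "Sup G - 1 / (real k + 1) < g"
      using less_cSupE[OF _ ne] by blast
    then obtain K2 where K2: "g = gap K2 (d k) 1" "nested K2" "\<And>n. K2 n \<subseteq> K1 n" by (auto simp: G_def)
    have "gap L (d k) 1 \<le> gap K2 (d k) 1 + 1 / (real k + 1)"
      if "nested L" "\<forall>n. L n \<subseteq> K1 n" for L
      using cSup_upper[OF _ bdd, of "gap L (d k) 1"] that g(2) K2(1) by (force simp: G_def)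
    then show "\<exists>K2. (nested K2 \<and> (\<forall>n. K2 n \<subseteq> K0 n)) \<and> Q k K1 K2"
      using K2(2,3) K1 unfolding Q_def by (meson subset_trans)
  qed
  from this[OF K] obtain \<K> where \<K>: "\<And>k. nested (\<K> k)" "\<And>k n. \<K> k n \<subseteq> K n"
    and Q: "\<And>k. Q k (\<K> k) (\<K> (Suc k))" by blast
  have mono1: "\<K> j n \<subseteq> \<K> i n" if "i \<le> j" for i j n
    using that by (induction rule: dec_induct) (use Q in \<open>auto simp: Q_def\<close>)
  have mono: "\<K> j m \<subseteq> \<K> i n" if "i \<le> j" "n \<le> m" for i j m n
    using mono1[OF that(1)] nestedD(1)[OF \<K>(1) that(2)] by blast
  define K' where "K' n = \<K> n n" for n
  have nK': "nested K'"
    unfolding nested_def K'_def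
    using \<K>(1) mono by (auto simp: nested_def)
  have maximal: "gap L (e j) 1 \<le> gap K' (e j) 1" if L: "nested L" "\<And>n. L n \<subseteq> K' n" for L j
  proof (rule field_le_epsilon)
    fix \<epsilon> :: real assume "\<epsilon> > 0"
    then obtain b where b: "1 / (real b + 1) < \<epsilon>"
      using reals_Archimedean[of \<epsilon>] by (auto simp: field_simps)
    define k where "k = prod_encode (j, b)"
    have dk: "d k = e j" by (simp add: d_def k_def)
    \<comment> \<open>The index \<open>k\<close> is a stage devoted to \<open>e j\<close> and so
      late that its error is below \<epsilon>.\<close>
    have kb: "b \<le> k" unfolding k_def by (rule le_prod_encode_2)
    \<comment> \<open>Early sets of \<open>L\<close> need not lie in stage \<open>k\<close>;
      delaying the sequence makes it a refinement of that stage without lowering the gap.\<close>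
    let ?L = "\<lambda>n. L (max n k)"
    have nL: "nested ?L" using L(1) unfolding nested_def by auto
    have sub: "?L n \<subseteq> \<K> k n" for n
      using L(2)[of "max n k"] mono[of k "max n k" n "max n k"] unfolding K'_def by auto
    have "gap L (e j) 1 \<le> gap ?L (e j) 1"
      by (rule gap_antimono[OF L(1) nL, where n = 0]) (use nestedD(1)[OF L(1)] in auto)
    also have "\<dots> \<le> gap (\<K> (Suc k)) (e j) 1 + 1 / (real k + 1)"
      using Q[of k] nL sub unfolding Q_def dk by blast
    also have "gap (\<K> (Suc k)) (e j) 1 \<le> gap K' (e j) 1"
      by (rule gap_antimono[OF \<K>(1) nK', where n = "Suc k"]) (use mono in \<open>auto simp: K'_def\<close>)
    also have "1 / (real k + 1) \<le> 1 / (real b + 1)" using kb by (simp add: frac_le)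
    finally show "gap L (e j) 1 \<le> gap K' (e j) 1 + \<epsilon>" using b by simp
  qed
  have maximal': "gap L f 1 \<le> gap K' f 1"
    if L: "nested L" "\<And>n. L n \<subseteq> K' n" and f: "f \<in> closure (range e)" for L f
  proof (rule field_le_epsilon)
    fix \<epsilon> :: real assume "\<epsilon> > 0"
    then obtain j where "dist (e j) f < \<epsilon>/2"
      using f unfolding closure_approachable by (metis half_gt_zero imageE)
    then have j: "norm (f - e j) < \<epsilon>/2" "norm (e j - f) < \<epsilon>/2"
      by (simp_all add: dist_norm norm_minus_commute)
    have "gap L f 1 \<le> gap L (e j) 1 + norm (f - e j)" by (rule gap_add_norm[OF L(1)])
    also have "gap L (e j) 1 \<le> gap K' (e j) 1" by (rule maximal[OF L])
    also have "\<dots> \<le> gap K' f 1 + norm (e j - f)" by (rule gap_add_norm[OF nK'])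
    finally show "gap L f 1 \<le> gap K' f 1 + \<epsilon>" using j by simp
  qed
  show ?thesis
  proof (rule that[OF nK'])
    show "K' n \<subseteq> K n" for n by (simp add: K'_def \<K>(2))
    fix f :: "'a \<Rightarrow>\<^sub>L real" and x :: 'a assume f: "f \<in> closure (range e)" and x: "norm x \<le> 1"
    show "blinfun_apply f x + upper_limit K' (- x) \<le> gap K' f 1"
    proof (rule field_le_epsilon)
      fix \<epsilon> :: real assume \<epsilon>: "\<epsilon> > 0"
      define c where "c = \<epsilon> - upper_limit K' (- x)"
      \<comment> \<open>\<open>L\<close> keeps the functionals whose value at \<open>x\<close>
        exceeds the lower limit there by at most \<epsilon>. It is a refinement with upper limit at
        most \<open>c\<close> at \<open>x\<close>, and maximality of the gap of \<open>K'\<close>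
        applies to it.\<close>
      define L where "L n = {g \<in> K' n. blinfun_apply g x \<le> c}" for n
      have convex: "convex (L n)" for n
        using convex_Int[OF nestedD(2)[OF nK', of n] convex_blinfun_halfspace[of x c]]
        by (simp add: L_def Int_def)
      have ne: "L n \<noteq> {}" for n
      proof
        assume "L n = {}"
        then have "upper_limit K' (- x) \<le> - c"
          by (intro upper_limit_leI[OF nK', where n = n]) (auto simp: L_def blinfun.minus_right)
        then show False using \<epsilon> by (simp add: c_def)
      qed
      have nL: "nested L"
        using convex ne nestedD(1,4)[OF nK'] unfolding nested_def L_def by fastforce
      have "upper_limit L x \<le> c"
        by (rule upper_limit_leI[OF nL, where n = 0]) (simp add: L_def)
      moreover have "blinfun_apply f x - 1 * upper_limit L x \<le> gap L f 1"
        by (rule gap_upper[OF nL x])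
      moreover have "gap L f 1 \<le> gap K' f 1"
        by (rule maximal'[OF nL _ f]) (auto simp: L_def)
      ultimately show "blinfun_apply f x + upper_limit K' (- x) \<le> gap K' f 1 + \<epsilon>"
        by (simp add: c_def)
    qed
  qed
qed

text \<open>Each \<open>a n\<close> nearly minimises \<phi> at the next partial sum. By
  sublinearity, a guaranteed gain at rate \<eta> for every choice in \<open>A n\<close> persists for
  the next choice, up to the minimisation error, so the rate stays above \<theta>.\<close>

lemma James_selection:
  fixes \<phi> :: "'v::real_vector \<Rightarrow> real"
  assumes \<phi>: "sublinear \<phi>"
    and A: "\<And>n. A (Suc n) \<subseteq> A n" "\<And>n. convex (A n)" "\<And>n. A n \<noteq> {}"
    and \<beta>: "\<And>n. \<beta> n > 0"
    and low: "\<And>a. a \<in> A 0 \<Longrightarrow> \<theta>' \<le> \<phi> a" "\<theta> < \<theta>'"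
  obtains a where "\<And>n. a n \<in> A n"
    "\<And>n. \<phi> (\<Sum>i<n. \<beta> i *\<^sub>R a i) + \<beta> n * \<theta> \<le> \<phi> (\<Sum>i<Suc n. \<beta> i *\<^sub>R a i)"
proof -
  \<comment> \<open>The rate \<eta> may shrink from stage to stage but stays strictly above
    \<theta>. The clause for \<open>n = 0\<close> pins the start, so that \<open>u n\<close> is the
    partial sum.\<close>
  define P where "P n u \<longleftrightarrow> (n = 0 \<longrightarrow> u = 0) \<and>
      (\<exists>\<eta>>\<theta>. \<forall>a\<in>A n. \<phi> u + \<beta> n * \<eta> \<le> \<phi> (u + \<beta> n *\<^sub>R a))" for n u
  define Q where "Q n u u' \<longleftrightarrow> (\<exists>a\<in>A n. u' = u + \<beta> n *\<^sub>R a)" for n u u'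
  have "\<exists>u. \<forall>n. P n (u n) \<and> Q n (u n) (u (Suc n))"
  proof (rule dependent_nat_choice)
    have "\<phi> 0 + \<beta> 0 * \<theta>' \<le> \<phi> (0 + \<beta> 0 *\<^sub>R a)" if "a \<in> A 0" for a
      using low(1)[OF that] \<beta>[of 0] sublinear_scale[OF \<phi>, of "\<beta> 0" a]
      by (simp add: sublinear_zero[OF \<phi>])
    then show "\<exists>u. P 0 u" using low(2) by (auto simp: P_def)
    fix u n assume "P n u"
    then obtain \<eta> where \<eta>: "\<eta> > \<theta>" "\<And>a. a \<in> A n \<Longrightarrow> \<phi> u + \<beta> n * \<eta> \<le> \<phi> (u + \<beta> n *\<^sub>R a)"
      by (auto simp: P_def)
    define I where "I = (INF a\<in>A n. \<phi> (u + \<beta> n *\<^sub>R a))"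
    have I_le: "I \<le> \<phi> (u + \<beta> n *\<^sub>R a)" if "a \<in> A n" for a
      unfolding I_def by (rule cINF_lower[OF bdd_belowI2 that]) (rule \<eta>(2))
    have I_ge: "\<phi> u + \<beta> n * \<eta> \<le> I"
      unfolding I_def by (rule cINF_greatest[OF A(3)]) (rule \<eta>(2))
    \<comment> \<open>This slack costs half of the margin of \<eta> over \<theta>, leaving the rate
      \<open>(\<eta> + \<theta>) / 2\<close>.\<close>
    let ?r = "\<beta> (Suc n) * ((\<eta> - \<theta>) / 2)"
    have "I < I + ?r" using \<eta>(1) \<beta>[of "Suc n"] by simp
    then obtain a where a: "a \<in> A n" "\<phi> (u + \<beta> n *\<^sub>R a) < I + ?r"
      using cInf_lessD[of "(\<lambda>a. \<phi> (u + \<beta> n *\<^sub>R a)) ` A n" "I + ?r"] A(3)[of n]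
      by (auto simp: I_def)
    have "\<phi> (u + \<beta> n *\<^sub>R a) + \<beta> (Suc n) * ((\<eta> + \<theta>) / 2) \<le> \<phi> (u + \<beta> n *\<^sub>R a + \<beta> (Suc n) *\<^sub>R a')"
      if "a' \<in> A (Suc n)" for a'
    proof -
      let ?b = "\<beta> n" and ?b' = "\<beta> (Suc n)"
      let ?y = "u + ?b *\<^sub>R a + ?b' *\<^sub>R a'"
      have pos: "?b > 0" "?b' > 0" "?b + ?b' > 0" using \<beta> by (simp_all add: add_pos_pos)
      \<comment> \<open>The weighted mean of \<open>a\<close> and \<open>a'\<close> lies in
        \<open>A n\<close>, so the infimum \<open>I\<close> applies to it; its weights make the
        scaled point a combination of \<open>?y\<close> and \<open>u\<close>.\<close>
      let ?m = "(?b / (?b + ?b')) *\<^sub>R a + (?b' / (?b + ?b')) *\<^sub>R a'"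
      have m: "?m \<in> A n"
        using pos by (intro convexD[OF A(2) a(1)] subsetD[OF A(1) that]) (auto simp flip: add_divide_distrib)
      have "(?b + ?b') * I \<le> (?b + ?b') * \<phi> (u + ?b *\<^sub>R ?m)"
        using I_le[OF m] pos by (intro mult_left_mono) auto
      also have "\<dots> = \<phi> ((?b + ?b') *\<^sub>R (u + ?b *\<^sub>R ?m))"
        using pos by (subst sublinear_scale[OF \<phi>]) auto
      also have "(?b + ?b') *\<^sub>R (u + ?b *\<^sub>R ?m) = ?b *\<^sub>R ?y + ?b' *\<^sub>R u"
        using pos by (simp add: scaleR_add_right scaleR_add_left mult.commute)
      also have "\<phi> \<dots> \<le> ?b * \<phi> ?y + ?b' * \<phi> u"
        using sublinear_add[OF \<phi>, of "?b *\<^sub>R ?y" "?b' *\<^sub>R u"] pos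
        by (simp add: sublinear_scale[OF \<phi>])
      finally have "?b * I + ?b' * (I - \<phi> u) \<le> ?b * \<phi> ?y" by (simp add: algebra_simps)
      moreover have "?b' * (?b * \<eta>) \<le> ?b' * (I - \<phi> u)"
        using I_ge pos by (intro mult_left_mono) auto
      ultimately have "?b * (I + ?b' * \<eta>) \<le> ?b * \<phi> ?y" by (simp add: algebra_simps)
      then have "I + ?b' * \<eta> \<le> \<phi> ?y" using pos by simp
      then show ?thesis using a(2) by (simp add: field_simps)
    qed
    then have "P (Suc n) (u + \<beta> n *\<^sub>R a)"
      using \<eta>(1) unfolding P_def by (intro conjI exI[of _ "(\<eta> + \<theta>) / 2"]) auto
    then show "\<exists>u'. P (Suc n) u' \<and> Q n u u'" using a(1) by (auto simp: Q_def)
  qed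
  then obtain u where P: "\<And>n. P n (u n)" and "\<And>n. \<exists>a\<in>A n. u (Suc n) = u n + \<beta> n *\<^sub>R a"
    unfolding Q_def by blast
  then obtain a where a: "\<And>n. a n \<in> A n" "\<And>n. u (Suc n) = u n + \<beta> n *\<^sub>R a n" by metis
  have u: "u n = (\<Sum>i<n. \<beta> i *\<^sub>R a i)" for n
    by (induction n) (use P[of 0] in \<open>auto simp: P_def a(2)\<close>)
  show ?thesis
  proof (rule that[OF a(1)])
    fix n
    obtain \<eta> where \<eta>: "\<eta> > \<theta>" "\<phi> (u n) + \<beta> n * \<eta> \<le> \<phi> (u n + \<beta> n *\<^sub>R a n)"
      using P[of n] a(1)[of n] by (auto simp: P_def)
    have "\<beta> n * \<theta> \<le> \<beta> n * \<eta>" using \<eta>(1) \<beta>[of n] by simp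
    with \<eta>(2) show "\<phi> (\<Sum>i<n. \<beta> i *\<^sub>R a i) + \<beta> n * \<theta> \<le> \<phi> (\<Sum>i<Suc n. \<beta> i *\<^sub>R a i)"
      by (simp add: u a(2))
  qed
qed

theorem James:
  assumes attain: "\<And>f :: 'a::banach \<Rightarrow>\<^sub>L real. \<exists>x. norm x \<le> 1 \<and> blinfun_apply f x = norm f"
  shows "reflexive_space TYPE('a)"
proof (rule ccontr)
  assume "\<not> reflexive_space TYPE('a)"
  then obtain \<theta> and h :: "nat \<Rightarrow> 'a \<Rightarrow>\<^sub>L real" and y :: "nat \<Rightarrow> 'a"
    where \<theta>: "\<theta> > 0" and h: "\<And>n. norm (h n) \<le> 1" and y: "\<And>n. norm (y n) \<le> 1"
      and big: "\<And>i n. i \<le> n \<Longrightarrow> blinfun_apply (h i) (y n) \<ge> 2 * \<theta>"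
      and small: "\<And>i n. n < i \<Longrightarrow> blinfun_apply (h i) (y n) \<le> \<theta>"
    using nonreflexive_sequences by blast
  obtain e :: "nat \<Rightarrow> 'a \<Rightarrow>\<^sub>L real" where e: "span (range h) \<subseteq> closure (range e)"
    by (rule rational_span_dense)
  define H where "H n = convex hull (h ` {n..})" for n
  have "nested H" unfolding H_def[abs_def] by (rule nested_convex_hull[OF h])
  then obtain K where K: "nested K" and "\<And>n. K n \<subseteq> H n"
    and Pryce: "\<And>f x. f \<in> closure (range e) \<Longrightarrow> norm x \<le> 1 \<Longrightarrow>
      blinfun_apply f x + upper_limit K (- x) \<le> gap K f 1"
    by (rule Pryce[where e = e]) blast
  then have K_sub: "K n \<subseteq> convex hull (h ` {n..})" for n by (simp add: H_def)
  \<comment> \<open>A convex combination of the \<open>h i\<close> is at least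
    \<open>2 * \<theta>\<close> at all late \<open>y n\<close>, while tails beyond such an
    \<open>n\<close> are at most \<theta> there; \<open>y n\<close> witnesses the gap.\<close>
  have gap_ge: "\<theta> \<le> gap K f 1" if f: "f \<in> K 0" for f
  proof -
    let ?S = "{f. \<exists>N. \<forall>n\<ge>N. blinfun_apply f (y n) \<ge> 2 * \<theta>}"
    have "convex ?S"
    proof (rule convexI)
      fix f g and s t :: real
      assume "f \<in> ?S" "g \<in> ?S" and st: "0 \<le> s" "0 \<le> t" "s + t = 1"
      then obtain M N where M: "\<And>n. n \<ge> M \<Longrightarrow> blinfun_apply f (y n) \<ge> 2 * \<theta>"
        and N: "\<And>n. n \<ge> N \<Longrightarrow> blinfun_apply g (y n) \<ge> 2 * \<theta>" by auto
      have "blinfun_apply (s *\<^sub>R f + t *\<^sub>R g) (y n) \<ge> 2 * \<theta>" if n: "n \<ge> max M N" for n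
      proof -
        have "s * (- blinfun_apply f (y n)) + t * (- blinfun_apply g (y n)) \<le> - (2 * \<theta>)"
          using M[of n] N[of n] n st by (intro convex_bound_le) auto
        then show ?thesis by (simp add: blinfun.add_left blinfun.scaleR_left)
      qed
      then show "s *\<^sub>R f + t *\<^sub>R g \<in> ?S" by blast
    qed
    moreover have "h ` {0..} \<subseteq> ?S" using big by blast
    ultimately have "convex hull (h ` {0..}) \<subseteq> ?S" by (intro hull_minimal)
    then obtain n where n: "blinfun_apply f (y n) \<ge> 2 * \<theta>" using f K_sub[of 0] by blast
    have "convex hull (h ` {Suc n..}) \<subseteq> {f. blinfun_apply f (y n) \<le> \<theta>}"
      by (rule hull_minimal) (use small convex_blinfun_halfspace in auto)
    then have "upper_limit K (y n) \<le> \<theta>"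
      by (intro upper_limit_leI[OF K, where n = "Suc n"]) (use K_sub[of "Suc n"] in blast)
    with n gap_upper[OF K y, of f n 1] show ?thesis by simp
  qed
  define \<eta> where "\<eta> = \<theta> / 2"
  have \<eta>: "\<eta> > 0" "\<eta> < \<theta>" using \<theta> by (simp_all add: \<eta>_def)
  \<comment> \<open>The bound \<open>\<eta> / 8\<close> makes the tail \<open>4 * r ^ Suc n\<close>
    at most half of the gain \<open>r ^ n * \<eta>\<close>; the bound 1/2 keeps the geometric sums
    at most 2.\<close>
  define r where "r = min (1/2) (\<eta> / 8)"
  have r: "r > 0" "r \<le> 1/2" "4 * r \<le> \<eta> / 2" using \<eta> by (auto simp: r_def)
  \<comment> \<open>The constant second coordinate accumulates the weights, so the partial sums are
    the pairs \<open>(u n, s n)\<close>.\<close>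
  obtain a where a: "\<And>n. a n \<in> K n \<times> {1}"
    and inc: "\<And>n. (\<lambda>(f, s). gap K f s) (\<Sum>i<n. r ^ i *\<^sub>R a i) + r ^ n * \<eta>
        \<le> (\<lambda>(f, s). gap K f s) (\<Sum>i<Suc n. r ^ i *\<^sub>R a i)"
  proof (rule James_selection[OF sublinear_gap[OF K], of "\<lambda>n. K n \<times> {1}" "\<lambda>n. r ^ n" \<theta> \<eta>])
    show "K (Suc n) \<times> {1} \<subseteq> K n \<times> {1}" for n using nestedD(1)[OF K, of n "Suc n"] by auto
    show "convex (K n \<times> {1})" for n by (intro convex_Times nestedD(2)[OF K] convex_singleton)
    show "K n \<times> {1} \<noteq> {}" for n using nestedD(3)[OF K] by auto
  qed (use r \<eta> gap_ge in auto)
  define g where "g n = fst (a n)" for n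
  define u where "u n = (\<Sum>i<n. r ^ i *\<^sub>R g i)" for n
  define s where "s n = (\<Sum>i<n. r ^ i)" for n
  have g: "g n \<in> K n" "a n = (g n, 1)" for n using a[of n] by (auto simp: g_def)
  have "(\<Sum>i<n. r ^ i *\<^sub>R a i) = (u n, s n)" for n
    by (induction n) (simp_all add: u_def s_def g(2) zero_prod_def)
  then have inc: "gap K (u n) (s n) + r ^ n * \<eta> \<le> gap K (u (Suc n)) (s (Suc n))" for n
    using inc[of n] by simp
  have s0: "s n \<ge> 0" for n unfolding s_def using r by (intro sum_nonneg) auto
  have gn: "norm (g n) \<le> 1" for n by (rule nestedD(4)[OF K g(1)])
  let ?L = "\<lambda>n. convex hull (g ` {n..})"
  have L: "nested ?L" by (rule nested_convex_hull[OF gn])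
  have L_sub: "?L n \<subseteq> K n" for n
    by (rule hull_minimal) (use g(1) nestedD(1)[OF K] nestedD(2)[OF K] in blast)+
  obtain w where w: "linear w" "\<And>x. w x \<le> upper_limit ?L x"
    using Hahn_Banach_sublinear[OF sublinear_upper_limit[OF L]] by blast
  have w_abs: "\<bar>w x\<bar> \<le> norm x" for x
    using w(2)[of x] w(2)[of "- x"] abs_upper_limit_le[OF L, of x] abs_upper_limit_le[OF L, of "- x"]
      linear_neg[OF w(1), of x] by simp
  have "bounded_linear w"
    by (rule bounded_linear_intro[where K = 1])
      (use w_abs in \<open>auto simp: linear_add[OF w(1)] linear_scale[OF w(1)]\<close>)
  then obtain W where W: "blinfun_apply W = w" by (metis bounded_linear_Blinfun_apply)
  have Wn: "norm W \<le> 1"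
    by (rule norm_blinfun_bound) (use w_abs W in auto)
  have w_le: "w x \<le> upper_limit K x" for x
    using w(2)[of x] upper_limit_mono[OF K L, where n = 0] L_sub by (meson order_trans)
  \<comment> \<open>Replacing the upper limit by \<open>W\<close> turns the pair
    \<open>(u n, s n)\<close> into a functional; the limit \<open>G\<close> of these is the one
    whose norm attainment is contradictory.\<close>
  define U where "U n = u n - s n *\<^sub>R W" for n
  have U_Suc: "U (Suc n) = U n + r ^ n *\<^sub>R (g n - W)" for n
    by (simp add: U_def u_def s_def algebra_simps)
  have zn: "norm (g n - W) \<le> 2" for n
    using norm_triangle_ineq4[of "g n" W] gn[of n] Wn by simp
  \<comment> \<open>The factor \<open>1 - r ^ k\<close> makes the geometric bound inductive, the new
    term being absorbed because \<open>2 \<le> 4 * (1 - r)\<close>.\<close>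
  have U_diff: "norm (U (n + k) - U n) \<le> 4 * r ^ n * (1 - r ^ k)" for n k
  proof (induction k)
    case (Suc k)
    have "U (n + Suc k) - U n = (U (n + k) - U n) + r ^ (n + k) *\<^sub>R (g (n + k) - W)"
      by (simp add: U_Suc)
    also have "norm \<dots> \<le> 4 * r ^ n * (1 - r ^ k) + r ^ (n + k) * 2"
      using Suc r zn by (intro norm_triangle_mono) (auto intro!: mult_left_mono)
    also have "r ^ (n + k) * 2 \<le> r ^ (n + k) * (4 * (1 - r))"
      using r by (intro mult_left_mono) auto
    also have "4 * r ^ n * (1 - r ^ k) + r ^ (n + k) * (4 * (1 - r)) = 4 * r ^ n * (1 - r ^ Suc k)"
      by (simp add: power_add algebra_simps)
    finally show ?case by simp
  qed simp
  have U_sum: "U n = (\<Sum>i<n. r ^ i *\<^sub>R (g i - W))" for n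
    by (induction n) (simp_all add: U_Suc, simp add: U_def u_def s_def)
  have "summable (\<lambda>i. r ^ i *\<^sub>R (g i - W))"
  proof (rule summable_comparison_test')
    show "summable (\<lambda>i. r ^ i * 2)"
      using r by (intro summable_mult2 summable_geometric) auto
    show "norm (r ^ i *\<^sub>R (g i - W)) \<le> r ^ i * 2" for i
      using r zn by (auto intro!: mult_left_mono)
  qed
  then obtain G where G: "U \<longlonglongrightarrow> G"
    using summable_LIMSEQ[of "\<lambda>i. r ^ i *\<^sub>R (g i - W)"] unfolding U_sum[abs_def, symmetric] by blast
  obtain x where x: "norm x \<le> 1" "blinfun_apply G x = norm G" using attain by blast
  have tail: "norm (G - U n) \<le> 4 * r ^ n" for n
  proof (rule tendsto_upperbound)
    show "(\<lambda>k. norm (U (k + n) - U n)) \<longlonglongrightarrow> norm (G - U n)"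
      by (intro tendsto_norm tendsto_diff tendsto_const LIMSEQ_ignore_initial_segment[OF G])
    have "norm (U (k + n) - U n) \<le> 4 * r ^ n" for k
    proof -
      have "4 * r ^ n * (1 - r ^ k) \<le> 4 * r ^ n * 1" using r by (intro mult_left_mono) auto
      with U_diff[of n k] show ?thesis by (simp add: add.commute)
    qed
    then show "\<forall>\<^sub>F k in sequentially. norm (U (k + n) - U n) \<le> 4 * r ^ n" by simp
  qed simp
  have u_span: "u n \<in> span (range h)" for n
  proof -
    have "g i \<in> span (range h)" for i
      using g(1)[of i] K_sub[of i] convex_hull_subset_span[of "h ` {i..}"] span_mono[of "h ` {i..}" "range h"]
      by blast
    then show ?thesis unfolding u_def by (intro span_sum span_scale)
  qed
  \<comment> \<open>\<open>w x\<close> is at least the lower limit of \<open>K\<close> at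
    \<open>x\<close>, so Pryce's inequality, applied after dividing by \<open>s n\<close>, bounds
    \<open>U n\<close> at \<open>x\<close>. At \<open>n = 0\<close> the divisor vanishes and
    everything is 0.\<close>
  have gap_low: "blinfun_apply (U n) x \<le> gap K (u n) (s n)" for n
  proof (cases "n = 0")
    case True
    then show ?thesis using gap_upper[OF K x(1), of 0 0] by (simp add: U_def u_def s_def)
  next
    case False
    have s: "s n > 0" unfolding s_def using r False by (intro sum_pos) auto
    have "(1 / s n) *\<^sub>R u n \<in> closure (range e)" using e span_scale[OF u_span] by blast
    then have "s n * (blinfun_apply ((1 / s n) *\<^sub>R u n) x + upper_limit K (- x))
        \<le> s n * gap K ((1 / s n) *\<^sub>R u n) 1"
      using Pryce x(1) s by (intro mult_left_mono) auto
    also have "\<dots> = gap K (u n) (s n)"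
      using sublinear_scale[OF sublinear_gap[OF K], of "s n" "((1 / s n) *\<^sub>R u n, 1)"] s by simp
    finally have "blinfun_apply (u n) x + s n * upper_limit K (- x) \<le> gap K (u n) (s n)"
      using s by (simp add: blinfun.scaleR_left distrib_left)
    moreover have "s n * (- w x) \<le> s n * upper_limit K (- x)"
      using s w_le[of "- x"] linear_neg[OF w(1), of x] by (intro mult_left_mono) auto
    ultimately show ?thesis by (simp add: U_def blinfun.diff_left blinfun.scaleR_left W)
  qed
  have gap_high: "gap K (u n) (s n) \<le> norm (U n)" for n
  proof (rule gap_least)
    fix v :: 'a assume v: "norm v \<le> 1"
    have "s n * w v \<le> s n * upper_limit K v" using s0 w_le by (intro mult_left_mono)
    then have "blinfun_apply (u n) v - s n * upper_limit K v \<le> blinfun_apply (U n) v"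
      by (simp add: U_def blinfun.diff_left blinfun.scaleR_left W)
    also have "\<dots> \<le> norm (U n)"
      using norm_blinfun[of "U n" v] mult_left_mono[OF v norm_ge_zero[of "U n"]] by simp
    finally show "blinfun_apply (u n) v - s n * upper_limit K v \<le> norm (U n)" .
  qed
  have gap_mono: "gap K (u m) (s m) \<le> gap K (u n) (s n)" if "m \<le> n" for m n
  proof (rule lift_Suc_mono_le[OF _ that])
    fix n
    have "0 \<le> r ^ n * \<eta>" using r(1) \<eta>(1) by simp
    then show "gap K (u n) (s n) \<le> gap K (u (Suc n)) (s (Suc n))" using inc[of n] by linarith
  qed
  \<comment> \<open>One guaranteed increment of the gap separates \<open>U n\<close> at
    \<open>x\<close> from the norms of all later \<open>U m\<close>, hence from
    \<open>norm G\<close>.\<close>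
  have G_ge: "blinfun_apply (U n) x + r ^ n * \<eta> \<le> norm G" for n
  proof (rule tendsto_lowerbound[OF tendsto_norm[OF G]])
    have "blinfun_apply (U n) x + r ^ n * \<eta> \<le> norm (U m)" if "m \<ge> Suc n" for m
      using gap_low[of n] inc[of n] gap_mono[OF that] gap_high[of m] by linarith
    then show "\<forall>\<^sub>F m in sequentially. blinfun_apply (U n) x + r ^ n * \<eta> \<le> norm (U m)"
      by (rule eventually_sequentiallyI)
  qed simp
  \<comment> \<open>As \<open>G\<close> attains its norm at \<open>x\<close>, the term of index
    \<open>n\<close> must supply the increment apart from the tail, which is at most half of it;
    dividing by \<open>r ^ n\<close> gives a bound uniform in \<open>n\<close>.\<close>
  have far: "w x + \<eta> / 2 \<le> blinfun_apply (g n) x" for n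
  proof -
    have "blinfun_apply (G - U (Suc n)) x \<le> norm (G - U (Suc n))"
      using norm_blinfun[of "G - U (Suc n)" x] mult_left_mono[OF x(1) norm_ge_zero[of "G - U (Suc n)"]]
      by simp
    also have "\<dots> \<le> r ^ n * (4 * r)" using tail[of "Suc n"] by (simp add: mult_ac)
    also have "\<dots> \<le> r ^ n * (\<eta> / 2)" using r by (intro mult_left_mono) auto
    finally have "norm G \<le> blinfun_apply (U (Suc n)) x + r ^ n * (\<eta> / 2)"
      using x(2) by (simp add: blinfun.diff_left)
    then have "r ^ n * \<eta> \<le> r ^ n * (blinfun_apply (g n) x - w x + \<eta> / 2)"
      using G_ge[of n] by (simp add: U_Suc blinfun.add_left blinfun.diff_left blinfun.scaleR_left W distrib_left)
    then show ?thesis using r(1) by simp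
  qed
  have "upper_limit ?L (- x) \<le> - (w x + \<eta> / 2)"
  proof (rule upper_limit_leI[OF L, where n = 0])
    have "blinfun_apply (g n) (- x) \<le> - (w x + \<eta> / 2)" for n
      using far[of n] by (simp add: blinfun.minus_right)
    then have "?L 0 \<subseteq> {f. blinfun_apply f (- x) \<le> - (w x + \<eta> / 2)}"
      by (intro hull_minimal convex_blinfun_halfspace) auto
    then show "blinfun_apply f (- x) \<le> - (w x + \<eta> / 2)" if "f \<in> ?L 0" for f using that by blast
  qed
  then show False using w(2)[of "- x"] linear_neg[OF w(1), of x] \<eta>(1) by simp
qed

section \<open>Hyperspaces and rank one operators\<close>

lemma dim_span_singleton:
  fixes v :: "'a::real_vector"
  assumes "v \<noteq> 0"
  shows "dim (span {v}) = 1"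
  by (simp add: dim_eq_card_independent dependent_single assms)

lemma rank_oneE:
  assumes "rank_one T"
  obtains c y where "y \<noteq> 0" "\<And>x. blinfun_apply T x = c x *\<^sub>R y" "\<exists>x. blinfun_apply T x \<noteq> 0"
proof -
  obtain B where B: "B \<subseteq> range (blinfun_apply T)" "independent B" "range (blinfun_apply T) \<subseteq> span B"
    "card B = 1"
    using basis_exists[of "range (blinfun_apply T)"] assms by (auto simp: rank_one_def)
  obtain y where y: "B = {y}" using B(4) card_1_singletonE by blast
  have y0: "y \<noteq> 0" using B(2) y dependent_zero by blast
  have "\<forall>x. \<exists>k. blinfun_apply T x = k *\<^sub>R y"
    using B(3) y by (auto simp: span_singleton)
  then obtain c where c: "\<And>x. blinfun_apply T x = c x *\<^sub>R y" by metis
  have "\<exists>x. blinfun_apply T x \<noteq> 0" using B(1) y y0 by auto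
  with y0 c show ?thesis by (rule that)
qed

text \<open>A vector \<open>v\<close> outside the kernel spans a line, which is not the whole space.
  Subtracting from a point off this line the multiple of \<open>v\<close> with the same image leaves
  a nonzero kernel vector.\<close>

lemma rank_one_kernel_meets_sphere:
  fixes T :: "'a::real_normed_vector \<Rightarrow>\<^sub>L 'a"
  assumes T: "rank_one T" and dim: "dim (UNIV :: 'a set) \<noteq> 1"
  obtains z where "norm z = 1" "blinfun_apply T z = 0"
proof -
  obtain c y where y: "y \<noteq> 0" and c: "\<And>x. blinfun_apply T x = c x *\<^sub>R y"
    and "\<exists>x. blinfun_apply T x \<noteq> 0"
    by (rule rank_oneE[OF T]) blast
  then obtain v where v: "c v \<noteq> 0" by auto
  have v0: "v \<noteq> 0" using v c[of 0] y by auto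
  have "span {v} \<noteq> UNIV" using dim_span_singleton[OF v0] dim by metis
  then obtain x where x: "x \<notin> span {v}" by blast
  define z where "z = x - (c x / c v) *\<^sub>R v"
  have "z \<noteq> 0" using x by (auto simp: z_def span_singleton)
  have "blinfun_apply T z = 0"
    using v by (simp add: z_def blinfun.diff_right blinfun.scaleR_right c)
  then show ?thesis
    by (intro that[of "z /\<^sub>R norm z"]) (use \<open>z \<noteq> 0\<close> in \<open>auto simp: blinfun.scaleR_right\<close>)
qed

lemma minimum_norm_attainment_set_rank_one:
  fixes T :: "'a::real_normed_vector \<Rightarrow>\<^sub>L 'a"
  assumes T: "rank_one T" and dim: "dim (UNIV :: 'a set) \<noteq> 1"
  shows "minimum_norm_attainment_set T = {x. blinfun_apply T x = 0} \<inter> sphere 0 1"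
proof -
  obtain z where z: "norm z = 1" "blinfun_apply T z = 0"
    by (rule rank_one_kernel_meets_sphere[OF assms])
  have "minimum_norm T \<le> norm (blinfun_apply T z)"
    unfolding minimum_norm_def
    by (rule cINF_lower) (use z in \<open>auto intro!: bdd_belowI2[where m = 0]\<close>)
  moreover have "0 \<le> minimum_norm T"
    unfolding minimum_norm_def by (rule cINF_greatest) (use z in auto)
  ultimately have "minimum_norm T = 0" using z by simp
  then show ?thesis by (auto simp: minimum_norm_attainment_set_def)
qed

text \<open>\<open>f x\<close> is the coordinate of \<open>x\<close> along a spanning vector
  \<open>v\<close> of the complement; its uniqueness gives linearity.\<close>

lemma hyperspaceE:
  assumes "hyperspace H"
  obtains v f where "v \<notin> H" "linear f" "f v = (1::real)" "H = {x. f x = 0}"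
proof -
  obtain L where H: "subspace H" and L: "subspace L" "dim L = 1" "H \<inter> L = {0}"
    and HL: "{h + l | h l. h \<in> H \<and> l \<in> L} = UNIV"
    using assms by (auto simp: hyperspace_def)
  obtain B where B: "B \<subseteq> L" "independent B" "L \<subseteq> span B" "card B = 1"
    using basis_exists[of L] L(2) by auto
  obtain v where v: "B = {v}" using B(4) card_1_singletonE by blast
  have v0: "v \<noteq> 0" using B(2) v dependent_zero by blast
  have vH: "v \<notin> H" using B(1) v v0 L(3) by blast
  have uniq: "s = t" if "x - s *\<^sub>R v \<in> H" "x - t *\<^sub>R v \<in> H" for x s t
  proof (rule ccontr)
    assume "s \<noteq> t"
    have "(s - t) *\<^sub>R v \<in> H"
      using subspace_diff[OF H that(2,1)] by (simp add: algebra_simps)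
    then have "(1 / (s - t)) *\<^sub>R ((s - t) *\<^sub>R v) \<in> H" by (rule subspace_scale[OF H])
    with \<open>s \<noteq> t\<close> vH show False by simp
  qed
  have "\<exists>t. x - t *\<^sub>R v \<in> H" for x
  proof -
    obtain h l where "x = h + l" "h \<in> H" "l \<in> L" using HL by blast
    moreover from this obtain t where "l = t *\<^sub>R v" using B(3) v by (auto simp: span_singleton)
    ultimately show ?thesis by (metis add_diff_cancel_right')
  qed
  then obtain f where f: "\<And>x. x - f x *\<^sub>R v \<in> H" by metis
  show ?thesis
  proof (rule that[OF vH])
    show "linear f"
    proof (rule linearI)
      fix x y
      show "f (x + y) = f x + f y"
        by (rule uniq[OF f]) (use subspace_add[OF H f[of x] f[of y]] in \<open>simp add: algebra_simps\<close>)
    next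
      fix t :: real and x
      show "f (t *\<^sub>R x) = t *\<^sub>R f x"
        by (rule uniq[OF f]) (use subspace_scale[OF H f[of x], of t] in \<open>simp add: algebra_simps\<close>)
    qed
    show "f v = 1" by (rule uniq[OF f]) (simp add: subspace_0[OF H])
    show "H = {x. f x = 0}"
    proof (rule set_eqI)
      fix x
      have "f x = 0" if "x \<in> H" by (rule uniq[OF f]) (use that in simp)
      moreover have "x \<in> H" if "f x = 0" using f[of x] that by simp
      ultimately show "x \<in> H \<longleftrightarrow> x \<in> {x. f x = 0}" by blast
    qed
  qed
qed

text \<open>If \<open>f v = 1\<close>, a ball of radius \<open>r\<close> around \<open>v\<close>
  misses the kernel, whereas \<open>v - (1 / f x) *\<^sub>R x\<close> lies in it; hence
  \<open>norm x / \<bar>f x\<bar>\<close> is at least \<open>r\<close>.\<close>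

lemma bounded_linear_closed_kernel:
  fixes f :: "'a::real_normed_vector \<Rightarrow> real"
  assumes f: "linear f" and closed: "closed {x. f x = 0}"
  shows "bounded_linear f"
proof (cases "\<exists>v. f v \<noteq> 0")
  case True
  then obtain v0 where v0: "f v0 \<noteq> 0" by blast
  define v where "v = (1 / f v0) *\<^sub>R v0"
  have v: "f v = 1" using v0 by (simp add: v_def linear_scale[OF f])
  have "open (- {x. f x = 0})" using closed by (rule open_Compl)
  then obtain r where r: "r > 0" "ball v r \<subseteq> - {x. f x = 0}"
    using v openE[of "- {x. f x = 0}" v] by auto
  have "\<bar>f x\<bar> \<le> norm x * (1 / r)" for x
  proof (cases "f x = 0")
    case False
    have "f (v - (1 / f x) *\<^sub>R x) = 0"
      using False v by (simp add: linear_diff[OF f] linear_scale[OF f])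
    then have "v - (1 / f x) *\<^sub>R x \<notin> ball v r" using r(2) by blast
    then have "r \<le> norm x / \<bar>f x\<bar>" by (simp add: dist_norm)
    then show ?thesis using False r(1) by (simp add: field_simps)
  qed (use r in simp)
  then show ?thesis
    by (intro bounded_linear_intro[where K = "1 / r"])
      (auto simp: linear_add[OF f] linear_scale[OF f])
next
  case False
  then have "f = (\<lambda>x. 0)" by auto
  then show ?thesis by simp
qed

text \<open>A functional on the dual that norms \<open>f\<close> is evaluation at a point, and the
  embedding is isometric.\<close>

lemma reflexive_norm_attained:
  fixes f :: "'a::real_normed_vector \<Rightarrow>\<^sub>L real"
  assumes "reflexive_space TYPE('a)"
  obtains x where "norm x \<le> 1" "blinfun_apply f x = norm f"
proof -
  obtain F :: "('a \<Rightarrow>\<^sub>L real) \<Rightarrow>\<^sub>L real" where F: "norm F \<le> 1" "blinfun_apply F f = norm f"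
    by (rule norming_functional)
  obtain x where x: "F = bidual_embedding x"
    using assms by (auto simp: reflexive_space_def surj_def)
  show ?thesis
    by (rule that[of x]) (use F in \<open>simp_all add: x norm_bidual_embedding bidual_embedding.rep_eq\<close>)
qed

lemma hyperspace_kernel:
  fixes f :: "'a::real_vector \<Rightarrow> real"
  assumes f: "linear f" and v: "f v \<noteq> 0"
  shows "hyperspace {x. f x = 0}"
  unfolding hyperspace_def
proof (intro conjI exI)
  show "subspace {x. f x = 0}"
    by (auto simp: subspace_def linear_0[OF f] linear_add[OF f] linear_scale[OF f])
  show "dim (span {v}) = 1" by (rule dim_span_singleton) (use v linear_0[OF f] in auto)
  show "{x. f x = 0} \<inter> span {v} = {0}"
    using v by (auto simp: span_singleton linear_scale[OF f] linear_0[OF f])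
  have "x \<in> {h + l | h l. h \<in> {x. f x = 0} \<and> l \<in> span {v}}" for x
  proof -
    have "x = (x - (f x / f v) *\<^sub>R v) + (f x / f v) *\<^sub>R v" by simp
    moreover have "f (x - (f x / f v) *\<^sub>R v) = 0"
      using v by (simp add: linear_diff[OF f] linear_scale[OF f])
    ultimately show ?thesis by (blast intro: span_scale span_base)
  qed
  then show "{h + l | h l. h \<in> {x. f x = 0} \<and> l \<in> span {v}} = UNIV" by blast
qed (rule subspace_span)

(* The one-dimensional space has to be excluded: there H = {0} is a closed hyperspace with
   empty unit sphere, whereas every operator attains its minimum norm on the unit sphere.
   As dim is 0 in infinite dimensions, the assumption excludes nothing else. *)
theorem theorem3p3:
  assumes "dim (UNIV :: 'a::banach set) \<noteq> 1"
  shows "reflexive_space TYPE('a) \<longleftrightarrow>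
    (\<forall>H :: 'a set. hyperspace H \<and> closed H \<longrightarrow>
      (\<exists>T :: 'a \<Rightarrow>\<^sub>L 'a. rank_one T \<and>
        (\<exists>x \<in> sphere 0 1. x \<in> norm_attainment_set T) \<and>
        minimum_norm_attainment_set T = H \<inter> sphere 0 1))"
    (is "_ \<longleftrightarrow> ?R")
proof
  assume refl: "reflexive_space TYPE('a)"
  show ?R
  proof (intro allI impI, elim conjE)
    fix H :: "'a set" assume "hyperspace H" and closed: "closed H"
    then obtain v f where v: "v \<notin> H" and lin: "linear f" and fv: "f v = (1::real)" and H: "H = {x. f x = 0}"
      by (elim hyperspaceE)
    have "bounded_linear f"
      by (rule bounded_linear_closed_kernel[OF lin]) (use closed H in simp)
    then obtain F where F: "blinfun_apply F = f" by (metis bounded_linear_Blinfun_apply)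
    have F0: "F \<noteq> 0" using F fv by auto
    have v0: "v \<noteq> 0" using fv linear_0[OF lin] by auto
    obtain x where x: "norm x \<le> 1" "f x = norm F"
      using reflexive_norm_attained[OF refl, of F] F by metis
    have "norm F \<le> norm F * norm x" using norm_blinfun[of F x] F x by simp
    then have x1: "norm x = 1" using x(1) F0 by simp
    \<comment> \<open>\<open>T\<close> has the kernel of \<open>f\<close>, and its norm is scaled by
      \<open>norm v\<close>, so it attains its norm where \<open>f\<close> does.\<close>
    define T where "T = Blinfun (\<lambda>z. f z *\<^sub>R v)"
    have T: "blinfun_apply T = (\<lambda>z. f z *\<^sub>R v)"
      unfolding T_def
      by (rule bounded_linear_Blinfun_apply) (use \<open>bounded_linear f\<close> in \<open>rule bounded_linear_scaleR_const\<close>)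
    have "k *\<^sub>R v \<in> range (blinfun_apply T)" for k
      by (rule range_eqI[of _ _ "k *\<^sub>R v"]) (simp add: T linear_scale[OF lin] fv)
    then have "range (blinfun_apply T) = span {v}" by (auto simp: T span_singleton)
    then have rank: "rank_one T" unfolding rank_one_def by (simp only: dim_span_singleton[OF v0])
    have "norm T = norm (blinfun_apply T x)"
    proof (rule antisym)
      show "norm (blinfun_apply T x) \<le> norm T" using norm_blinfun[of T x] x1 by simp
      show "norm T \<le> norm (blinfun_apply T x)"
      proof (rule norm_blinfun_bound)
        fix z
        have "\<bar>f z\<bar> * norm v \<le> (norm F * norm z) * norm v"
          using norm_blinfun[of F z] F by (intro mult_right_mono) auto
        then show "norm (blinfun_apply T z) \<le> norm (blinfun_apply T x) * norm z"
          by (simp add: T x(2) mult_ac)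
      qed simp
    qed
    then have "x \<in> norm_attainment_set T" using x1 by (simp add: norm_attainment_set_def)
    moreover have "{z. blinfun_apply T z = 0} = H" using v0 by (auto simp: T H)
    ultimately show "\<exists>T. rank_one T \<and> (\<exists>x\<in>sphere 0 1. x \<in> norm_attainment_set T) \<and>
        minimum_norm_attainment_set T = H \<inter> sphere 0 1"
      using rank minimum_norm_attainment_set_rank_one[OF rank assms] x1
      by (intro exI[of _ T]) auto
  qed
next
  assume R: ?R
  show "reflexive_space TYPE('a)"
  proof (rule James)
    fix f :: "'a \<Rightarrow>\<^sub>L real"
    have lin: "linear (blinfun_apply f)" by (simp add: blinfun.bounded_linear_right bounded_linear.linear)
    show "\<exists>x. norm x \<le> 1 \<and> blinfun_apply f x = norm f"
    proof (cases "f = 0")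
      case False
      then obtain v where v: "blinfun_apply f v \<noteq> 0" by (metis blinfun_eqI zero_blinfun.rep_eq)
      let ?H = "{x. blinfun_apply f x = 0}"
      have "closed ?H"
        by (intro closed_Collect_eq continuous_intros)
      with hyperspace_kernel[OF lin v] have "\<exists>T :: 'a \<Rightarrow>\<^sub>L 'a. rank_one T \<and>
          (\<exists>x\<in>sphere 0 1. x \<in> norm_attainment_set T) \<and>
          minimum_norm_attainment_set T = ?H \<inter> sphere 0 1"
        by (intro R[rule_format] conjI)
      then obtain T :: "'a \<Rightarrow>\<^sub>L 'a" and x
        where T: "rank_one T" and "x \<in> norm_attainment_set T"
          and m: "minimum_norm_attainment_set T = ?H \<inter> sphere 0 1"
        by blast
      then have x: "norm x = 1" "norm (blinfun_apply T x) = norm T"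
        by (simp_all add: norm_attainment_set_def)
      \<comment> \<open>The minimum norm set is the trace of the kernel of \<open>T\<close> on the
        sphere, and by homogeneity this trace determines the kernel.\<close>
      have kernel: "blinfun_apply T z = 0 \<longleftrightarrow> blinfun_apply f z = 0" for z
      proof (cases "z = 0")
        case False
        then have "z /\<^sub>R norm z \<in> sphere 0 1" by simp
        then have "blinfun_apply T (z /\<^sub>R norm z) = 0 \<longleftrightarrow> blinfun_apply f (z /\<^sub>R norm z) = 0"
          using m minimum_norm_attainment_set_rank_one[OF T assms] by blast
        then show ?thesis using False by (simp add: blinfun.scaleR_right)
      qed simp
      have "T \<noteq> 0" using kernel[of v] v by auto
      then have fx: "blinfun_apply f x \<noteq> 0" using x kernel[of x] by auto
      \<comment> \<open>Equal kernels make \<open>T z\<close> the multiple \<open>f z / f x\<close>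
        of \<open>T x\<close>, so attainment of the norm of \<open>T\<close> at \<open>x\<close>
        passes to \<open>f\<close>.\<close>
      have "norm f \<le> \<bar>blinfun_apply f x\<bar>"
      proof (rule norm_blinfun_bound)
        fix z
        let ?t = "blinfun_apply f z / blinfun_apply f x"
        have "blinfun_apply f (z - ?t *\<^sub>R x) = 0"
          using fx by (simp add: blinfun.diff_right blinfun.scaleR_right)
        then have "blinfun_apply T z = ?t *\<^sub>R blinfun_apply T x"
          using kernel[of "z - ?t *\<^sub>R x"] by (simp add: blinfun.diff_right blinfun.scaleR_right)
        then have "\<bar>?t\<bar> * norm T \<le> norm z * norm T"
          using norm_blinfun[of T z] x by (simp add: mult.commute)
        then have "\<bar>?t\<bar> \<le> norm z"
          by (rule mult_right_le_imp_le) (simp add: \<open>T \<noteq> 0\<close>)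
        then show "norm (blinfun_apply f z) \<le> \<bar>blinfun_apply f x\<bar> * norm z"
          using fx by (simp add: abs_divide field_simps)
      qed simp
      moreover have "\<bar>blinfun_apply f x\<bar> \<le> norm f" using norm_blinfun[of f x] x(1) by simp
      ultimately have eq: "\<bar>blinfun_apply f x\<bar> = norm f" by simp
      show ?thesis
      proof (cases "blinfun_apply f x \<ge> 0")
        case True
        then show ?thesis using eq x(1) by (intro exI[of _ x]) simp
      next
        case False
        then show ?thesis using eq x(1) by (intro exI[of _ "- x"]) (simp add: blinfun.minus_right)
      qed
    qed (auto intro!: exI[of _ 0])
  qed
qed

end
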